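(* Let $A$ and $B$ be two independent sets of the same size in a graph $G$. If the Piran graph $\Pi(A,B)$ is even-hole-free, then $A$ and $B$ are TJ-reconfigurable. Moreover, there is an algorithm running in time $O(|A|)$ that, when $\Pi(A,B)$ is even-hole-free, finds a shortest TJ-path between $A$ and $B$.
   Context: The Piran graph $\Pi(A,B)$ is the subgraph of $G$ induced by $(A\setminus B)\cup(B\setminus A)$. A hole is a chordless cycle with at least four vertices; even-hole-free means no induced even-length hole. TJ-graph of $G$: vertices are independent sets (token sets); two are adjacent if one is obtained from the other by moving one token to any unoccupied vertex so that the result is independent. TJ-reconfigurable means in the same connected component of the TJ-graph; a TJ-path is a path in the TJ-graph. *)

theory Defs
  imports "Graph_Theory.Graph_Theory" "HOL-Library.Landau_Symbols"
begin

section \<open>Independent sets, the Piran graph, and token jumping\<close>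

text \<open>
  A finite simple graph is a digraph satisfying the locale predicate \<open>graph\<close>, i.e. a finite
  symmetric digraph without loops and parallel arcs.
\<close>

definition independent_set :: "('a, 'b) pre_digraph \<Rightarrow> 'a set \<Rightarrow> bool" where
  "independent_set G S \<longleftrightarrow> S \<subseteq> verts G \<and> (\<forall>u\<in>S. \<forall>v\<in>S. \<not> u \<rightarrow>\<^bsub>G\<^esub> v)"

definition piran_graph :: "('a, 'b) pre_digraph \<Rightarrow> 'a set \<Rightarrow> 'a set \<Rightarrow> ('a, 'b) pre_digraph" where
  "piran_graph G A B = G \<restriction> ((A - B) \<union> (B - A))"

text \<open>
  Cycles are lists of arcs, so \<open>length p\<close> is the number of edges, and of vertices, of the cycle.
  The degenerate cycles \<open>u, v, u\<close> of a symmetric digraph are excluded by the length condition.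
  Chordlessness: every arc between vertices of the cycle has the same ends as an arc of the cycle.
\<close>

definition hole :: "('a, 'b) pre_digraph \<Rightarrow> 'b list \<Rightarrow> bool" where
  "hole G p \<longleftrightarrow> pre_digraph.cycle G p \<and> 4 \<le> length p \<and>
     (\<forall>e\<in>arcs G. tail G e \<in> tail G ` set p \<and> head G e \<in> tail G ` set p \<longrightarrow>
        (\<exists>f\<in>set p. {tail G e, head G e} = {tail G f, head G f}))"

definition even_hole_free :: "('a, 'b) pre_digraph \<Rightarrow> bool" where
  "even_hole_free G \<longleftrightarrow> \<not> (\<exists>p. hole G p \<and> even (length p))"

definition TJ_graph :: "('a, 'b) pre_digraph \<Rightarrow> 'a set pair_pre_digraph" where
  "TJ_graph G = \<lparr> pverts = {S. independent_set G S},
     parcs = {(S, T). independent_set G S \<and> independent_set G T \<and>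
                (\<exists>u\<in>S. \<exists>v\<in>verts G - S. T = insert v (S - {u}))} \<rparr>"

text \<open>
  Token moves are reversible, so the TJ-graph is symmetric and lying in the same connected
  component means being joined by a walk.
\<close>

definition TJ_reconfigurable :: "('a, 'b) pre_digraph \<Rightarrow> 'a set \<Rightarrow> 'a set \<Rightarrow> bool" where
  "TJ_reconfigurable G A B \<longleftrightarrow> A \<rightarrow>\<^sup>*\<^bsub>with_proj (TJ_graph G)\<^esub> B"

definition TJ_path :: "('a, 'b) pre_digraph \<Rightarrow> 'a set \<Rightarrow> 'a set \<Rightarrow> 'a set list \<Rightarrow> bool" where
  "TJ_path G A B P \<longleftrightarrow> vpath P (with_proj (TJ_graph G)) \<and> hd P = A \<and> last P = B"

definition shortest_TJ_path :: "('a, 'b) pre_digraph \<Rightarrow> 'a set \<Rightarrow> 'a set \<Rightarrow> 'a set list \<Rightarrow> bool" where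
  "shortest_TJ_path G A B P \<longleftrightarrow>
     TJ_path G A B P \<and> (\<forall>Q. TJ_path G A B Q \<longrightarrow> vwalk_length P \<le> vwalk_length Q)"


section \<open>A random access machine with running times\<close>

text \<open>
  Programs are structured programs over finitely many named registers and arrays holding natural
  numbers. The arithmetic is addition and truncated subtraction; there is no multiplication, so
  that the unit-cost measure is the usual one. Every node of an expression and every executed
  command costs one time unit.
\<close>

record memory =
  reg :: "string \<Rightarrow> nat"
  cell :: "string \<Rightarrow> nat \<Rightarrow> nat"

datatype aexp = Num nat | Reg string | Cell string aexp | Add aexp aexp | Sub aexp aexp

datatype bexp = Lt aexp aexp | Neg bexp | Conj bexp bexp

datatype com =
    Skip
  | Set_Reg string aexp
  | Set_Cell string aexp aexp
  | Seq com com
  | Cond bexp com com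
  | Loop bexp com

primrec aval :: "aexp \<Rightarrow> memory \<Rightarrow> nat" where
  "aval (Num n) s = n"
| "aval (Reg x) s = reg s x"
| "aval (Cell a e) s = cell s a (aval e s)"
| "aval (Add e f) s = aval e s + aval f s"
| "aval (Sub e f) s = aval e s - aval f s"

primrec bval :: "bexp \<Rightarrow> memory \<Rightarrow> bool" where
  "bval (Lt e f) s \<longleftrightarrow> aval e s < aval f s"
| "bval (Neg b) s \<longleftrightarrow> \<not> bval b s"
| "bval (Conj b c) s \<longleftrightarrow> bval b s \<and> bval c s"

primrec acost :: "aexp \<Rightarrow> nat" where
  "acost (Num n) = 1"
| "acost (Reg x) = 1"
| "acost (Cell a e) = 1 + acost e"
| "acost (Add e f) = 1 + acost e + acost f"
| "acost (Sub e f) = 1 + acost e + acost f"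

primrec bcost :: "bexp \<Rightarrow> nat" where
  "bcost (Lt e f) = 1 + acost e + acost f"
| "bcost (Neg b) = 1 + bcost b"
| "bcost (Conj b c) = 1 + bcost b + bcost c"

text \<open>\<open>runs c s t s'\<close>: started in \<open>s\<close>, the program \<open>c\<close> halts in \<open>s'\<close> after \<open>t\<close> time units.\<close>

inductive runs :: "com \<Rightarrow> memory \<Rightarrow> nat \<Rightarrow> memory \<Rightarrow> bool" where
  Skip: "runs Skip s 1 s"
| Set_Reg: "runs (Set_Reg x e) s (1 + acost e) (s\<lparr>reg := (reg s)(x := aval e s)\<rparr>)"
| Set_Cell: "runs (Set_Cell a e f) s (1 + acost e + acost f)
    (s\<lparr>cell := (cell s)(a := (cell s a)(aval e s := aval f s))\<rparr>)"
| Seq: "\<lbrakk>runs c s t s'; runs d s' u s''\<rbrakk> \<Longrightarrow> runs (Seq c d) s (1 + t + u) s''"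
| Cond_True: "\<lbrakk>bval b s; runs c s t s'\<rbrakk> \<Longrightarrow> runs (Cond b c d) s (1 + bcost b + t) s'"
| Cond_False: "\<lbrakk>\<not> bval b s; runs d s t s'\<rbrakk> \<Longrightarrow> runs (Cond b c d) s (1 + bcost b + t) s'"
| Loop_False: "\<not> bval b s \<Longrightarrow> runs (Loop b c) s (1 + bcost b) s"
| Loop_True: "\<lbrakk>bval b s; runs c s t s'; runs (Loop b c) s' u s''\<rbrakk>
    \<Longrightarrow> runs (Loop b c) s (1 + bcost b + t + u) s''"


section \<open>Input and output of a token jumping algorithm\<close>

text \<open>
  The vertices are natural numbers. The input consists of the common size of \<open>A\<close> and \<open>B\<close>, of
  listings of \<open>A\<close> and \<open>B\<close> in arbitrary order, and of the Piran graph in adjacency list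
  representation: the neighbours of a vertex \<open>v\<close> are listed, in arbitrary order, in the block of
  length \<open>deg[v]\<close> of the array \<open>adj\<close> that begins at \<open>start[v]\<close>.
  All the remaining memory has arbitrary contents.

  Adjacency lists of \<open>G\<close> itself would not do: they can be arbitrarily longer than \<open>|A|\<close>, and
  an edge of the Piran graph may be hidden anywhere in them.
\<close>

definition encodes_input :: "(nat, 'b) pre_digraph \<Rightarrow> nat set \<Rightarrow> nat set \<Rightarrow> memory \<Rightarrow> bool" where
  "encodes_input G A B s \<longleftrightarrow>
     reg s ''size'' = card A \<and>
     bij_betw (cell s ''A'') {..<card A} A \<and>
     bij_betw (cell s ''B'') {..<card B} B \<and>
     (\<forall>v\<in>verts (piran_graph G A B).
        bij_betw (\<lambda>i. cell s ''adj'' (cell s ''start'' v + i)) {..<cell s ''deg'' v}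
          {w. v \<rightarrow>\<^bsub>piran_graph G A B\<^esub> w})"

text \<open>
  Written out as a list of token sets, a TJ-path can have size quadratic in \<open>|A|\<close>. It is
  therefore output as the list of its moves: the \<open>i\<close>-th move takes the token on \<open>from[i]\<close>
  to \<open>to[i]\<close>. A malformed move, from an unoccupied or to an occupied vertex, does not lead to
  a neighbour in the TJ-graph.
\<close>

definition output_moves :: "memory \<Rightarrow> (nat \<times> nat) list" where
  "output_moves s = map (\<lambda>i. (cell s ''from'' i, cell s ''to'' i)) [0..<reg s ''moves'']"

primrec token_sets :: "'a set \<Rightarrow> ('a \<times> 'a) list \<Rightarrow> 'a set list" where
  "token_sets S [] = [S]"
| "token_sets S (m # ms) = S # token_sets (insert (snd m) (S - {fst m})) ms"

end

theory Submission
  imports Defs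
begin

text \<open>
  The Piran graph is bipartite. If it had a cycle, a shortest one would be an even hole, so an
  even-hole-free Piran graph is a forest. A forest with two equally large sides \<open>A - B\<close> and
  \<open>B - A\<close> has fewer edges than twice the size of a side, so some \<open>y \<in> B - A\<close> has at most one
  neighbour. The token on that neighbour, or on any vertex of \<open>A - B\<close> if there is none, can jump to
  \<open>y\<close>; both vertices leave the Piran graph, which remains a balanced forest. A move decreases
  \<open>card (A - B)\<close> by at most one, so these \<open>card (A - B)\<close> moves form a shortest path.

  The algorithm keeps the number of remaining neighbours of every \<open>y\<close>, and a queue of those \<open>y\<close> for
  which it is at most one. Its running time is linear because a forest has linearly many edges.
\<close>

section \<open>Even-hole-free bipartite graphs\<close>

text \<open>Acyclicity is used only in this form: every nonempty set of Piran vertices contains one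
  with at most one neighbour inside the set. A longest induced path yields the refuting chordless
  cycle directly, so no cycle has to be shortened. Such a vertex may lie in \<open>A - B\<close>,
  where it is useless: a jump needs a target that only the jumping token can block. Hence the edge
  count: its strict bound, together with equal sides, forces the average degree on the target side
  below two. The bound holds for every balanced remainder, so greedy choices never get stuck,
  whatever their order. A target without remaining neighbours still needs a source, and searching
  for one from scratch in every move would be quadratic. A pointer into the listing of
  \<open>A\<close> that only moves forward supplies it.\<close>

primrec induced_path :: "('a \<Rightarrow> 'a \<Rightarrow> bool) \<Rightarrow> 'a list \<Rightarrow> bool" where
  "induced_path E [] \<longleftrightarrow> True"
| "induced_path E (x # xs) \<longleftrightarrow> x \<notin> set xs \<and> (xs \<noteq> [] \<longrightarrow> E x (hd xs)) \<and>
     (\<forall>y\<in>set (tl xs). \<not> E x y) \<and> induced_path E xs"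

lemma induced_path_distinct: "induced_path E xs \<Longrightarrow> distinct xs"
  by (induction xs) auto

lemma induced_path_appendD: "induced_path E (xs @ ys) \<Longrightarrow> induced_path E xs"
proof (induction xs)
  case (Cons x xs)
  then show ?case by (cases "xs = []") auto
qed simp

lemma induced_path_arcs:
  "induced_path E xs \<Longrightarrow> (x, y) \<in> set (vwalk_arcs xs) \<Longrightarrow> E x y"
  by (induction xs rule: vwalk_arcs.induct) auto

text \<open>Among the later vertices, a vertex of an induced path sees only its successor, and
  symmetry settles the earlier ones. This excludes the chords of the closed cycle that avoid the
  closing vertex.\<close>

lemma induced_path_edges:
  assumes "induced_path E xs" "symp E" "\<And>x. \<not> E x x" "a \<in> set xs" "b \<in> set xs" "E a b"
  shows "(a, b) \<in> set (vwalk_arcs xs) \<or> (b, a) \<in> set (vwalk_arcs xs)"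
  using assms(1,4-)
proof (induction xs rule: vwalk_arcs.induct)
  case (3 x y xs)
  then show ?case using sympD[OF assms(2)] assms(3) by (auto; metis)
qed (use assms(3) in auto)

text \<open>
  The cycle is closed by a second neighbour \<open>u\<close> of the first vertex of a longest induced path:
  by maximality, \<open>u\<close> has a further neighbour on the path, and the path is cut at the first one.
\<close>

lemma chordless_cycle_exists:
  assumes "finite W" "W \<noteq> {}" "symp E" and irrefl: "\<And>x. \<not> E x x"
    and deg: "\<And>v u. v \<in> W \<Longrightarrow> \<exists>w\<in>W. E v w \<and> w \<noteq> u"
  obtains u xs where "induced_path E xs" "set xs \<subseteq> W" "u \<in> W" "u \<notin> set xs" "2 \<le> length xs"
    "E u (hd xs)" "E u (last xs)" "\<forall>z\<in>set xs. E u z \<longrightarrow> z = hd xs \<or> z = last xs"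
proof -
  let ?P = "\<lambda>xs. induced_path E xs \<and> set xs \<subseteq> W"
  have len: "length xs \<le> card W" if "?P xs" for xs
    using that induced_path_distinct[of E xs] card_mono[OF assms(1), of "set xs"]
    by (simp add: distinct_card)
  have "?P []" by simp
  then obtain xs where xs: "?P xs" and max: "\<And>ys. ?P ys \<Longrightarrow> length ys \<le> length xs"
    using ex_has_greatest_nat[of ?P "[]" length "Suc (card W)"] len by (auto simp: less_Suc_eq_le)
  obtain w where "w \<in> W" using assms(2) by blast
  then have "xs \<noteq> []" using max[of "[w]"] by auto
  then obtain x xs' where xs': "xs = x # xs'" by (cases xs) auto
  \<comment> \<open>Excluding the successor of \<open>x\<close> forces \<open>u\<close> off the
    path, since \<open>x\<close> has no other neighbour on it. For a one-vertex path
    \<open>hd xs'\<close> is an arbitrary value and the exclusion is harmless.\<close>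
  obtain u where u: "u \<in> W" "E x u" and u1: "xs' \<noteq> [] \<Longrightarrow> u \<noteq> hd xs'"
    using deg[of x "hd xs'"] xs xs' by auto
  have sym: "E a b \<Longrightarrow> E b a" for a b using assms(3) by (rule sympD)
  have "u \<notin> set xs'" using xs xs' u u1 by (cases xs') auto
  then have u2: "u \<notin> set xs" using u irrefl xs' by auto
  have "\<exists>y\<in>set xs'. E u y"
  proof (rule ccontr)
    assume "\<not> ?thesis"
    then have "?P (u # xs)" using xs xs' u u2 sym by auto
    then show False using max by fastforce
  qed
  then obtain ys y zs where ys: "xs' = ys @ y # zs" "E u y" "\<forall>z\<in>set ys. \<not> E u z"
    using split_list_first_prop[of xs' "E u"] by blast
  let ?C = "x # ys @ [y]"
  show ?thesis
  proof
    show "induced_path E ?C" using xs xs' ys induced_path_appendD[of E ?C zs] by simp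
    show "\<forall>z\<in>set ?C. E u z \<longrightarrow> z = hd ?C \<or> z = last ?C" using ys by auto
  qed (use xs xs' ys u u2 sym in auto)
qed

text \<open>Each arc changes sides, so the parity of the number of arcs decides whether the ends
  agree. On a closed walk this makes the number of arcs even.\<close>

lemma alternating_walk:
  assumes "set (vwalk_arcs xs) \<subseteq> {(a, b). a \<in> X \<longleftrightarrow> b \<notin> X}" "xs \<noteq> []"
  shows "(hd xs \<in> X \<longleftrightarrow> last xs \<in> X) \<longleftrightarrow> odd (length xs)"
  using assms by (induction xs rule: vwalk_arcs.induct) auto

section \<open>From vertex walks to holes given as arc lists\<close>

lemma awalk_of_vwalk:
  fixes G :: "('a, 'b) pre_digraph"
  assumes "vwalk xs G"
  obtains p where "pre_digraph.awalk G (hd xs) p (last xs)" "pre_digraph.awalk_verts G (hd xs) p = xs"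
    "map (\<lambda>e. (tail G e, head G e)) p = vwalk_arcs xs"
proof -
  have "\<exists>p. set p \<subseteq> arcs G \<and> pre_digraph.cas G (hd xs) p (last xs) \<and>
      pre_digraph.awalk_verts G (hd xs) p = xs \<and> map (\<lambda>e. (tail G e, head G e)) p = vwalk_arcs xs"
    using assms
  proof (induction rule: vwalk_induct)
    case (Base u)
    show ?case by (rule exI[of _ "[]"]) (simp add: pre_digraph.cas.simps pre_digraph.awalk_verts.simps)
  next
    case (Cons u v es)
    then obtain p where p: "set p \<subseteq> arcs G" "pre_digraph.cas G v p (last (v # es))"
      "pre_digraph.awalk_verts G v p = v # es"
      "map (\<lambda>e. (tail G e, head G e)) p = vwalk_arcs (v # es)" by auto
    obtain e where e: "e \<in> arcs G" "tail G e = u" "head G e = v" using Cons(1) by auto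
    show ?case
      by (rule exI[of _ "e # p"])
        (use p e in \<open>simp add: pre_digraph.cas.simps pre_digraph.awalk_verts.simps\<close>)
  qed
  moreover have "hd xs \<in> verts G" using assms by (auto simp: vwalk_def)
  ultimately show ?thesis using that unfolding pre_digraph.awalk_def by blast
qed

text \<open>The base point occurs twice in the closed vertex list, so five entries mean four arcs.
  Chordlessness transfers because the chosen arcs have exactly the ends listed in
  \<open>vwalk_arcs xs\<close>.\<close>

lemma hole_of_closed_walk:
  assumes "vwalk xs G" "hd xs = last xs" "distinct (tl xs)" "5 \<le> length xs"
    and chordless: "\<And>a b. a \<in> set xs \<Longrightarrow> b \<in> set xs \<Longrightarrow> a \<rightarrow>\<^bsub>G\<^esub> b \<Longrightarrow>
      (a, b) \<in> set (vwalk_arcs xs) \<or> (b, a) \<in> set (vwalk_arcs xs)"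
  obtains p where "hole G p" "length p = length xs - 1"
proof -
  obtain p where p: "pre_digraph.awalk G (hd xs) p (last xs)"
    "pre_digraph.awalk_verts G (hd xs) p = xs"
    and arcs: "map (\<lambda>e. (tail G e, head G e)) p = vwalk_arcs xs"
    by (rule awalk_of_vwalk[OF assms(1)])
  have len: "length p = length xs - 1"
    using arg_cong[OF arcs, of length] vwalk_length_simp[of xs, unfolded vwalk_length_def] by simp
  have cycle: "pre_digraph.cycle G p"
    unfolding pre_digraph.cycle_def using p assms len by auto
  have verts: "set (map fst (vwalk_arcs ys)) \<subseteq> set ys" for ys :: "'a list"
    by (induction ys rule: vwalk_arcs.induct) auto
  have tails: "tail G ` set p \<subseteq> set xs"
  proof -
    have "tail G ` set p = set (map fst (map (\<lambda>e. (tail G e, head G e)) p))" by force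
    also have "\<dots> \<subseteq> set xs" unfolding arcs by (rule verts)
    finally show ?thesis .
  qed
  have "\<exists>f\<in>set p. {tail G e, head G e} = {tail G f, head G f}"
    if "e \<in> arcs G" "tail G e \<in> tail G ` set p" "head G e \<in> tail G ` set p" for e
  proof -
    have "tail G e \<rightarrow>\<^bsub>G\<^esub> head G e" using that(1) by (auto simp: arcs_ends_conv)
    then have "(tail G e, head G e) \<in> set (vwalk_arcs xs) \<or> (head G e, tail G e) \<in> set (vwalk_arcs xs)"
      using chordless that tails by blast
    then show ?thesis unfolding arcs[symmetric] by auto
  qed
  then have "hole G p" unfolding hole_def using cycle len assms(4) by auto
  then show ?thesis using len that by blast
qed

lemma dominates_piran_graph:
  "u \<rightarrow>\<^bsub>piran_graph G A B\<^esub> v \<longleftrightarrow>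
     u \<rightarrow>\<^bsub>G\<^esub> v \<and> u \<in> (A - B) \<union> (B - A) \<and> v \<in> (A - B) \<union> (B - A)"
  unfolding piran_graph_def by (auto simp: arcs_ends_conv)

lemma piran_graph_bipartite:
  assumes "independent_set G A" "independent_set G B" "u \<rightarrow>\<^bsub>piran_graph G A B\<^esub> v"
  shows "u \<in> A \<longleftrightarrow> v \<notin> A"
  using assms unfolding dominates_piran_graph independent_set_def by blast

section \<open>Leaves and edge counts of the Piran graph\<close>

locale piran_forest =
  fixes G :: "('a, 'b) pre_digraph" and A B :: "'a set"
  assumes graph: "graph G" and indep: "independent_set G A" "independent_set G B"
    and card_eq: "card A = card B" and hole_free: "even_hole_free (piran_graph G A B)"
begin

lemma dominates_sym: "u \<rightarrow>\<^bsub>G\<^esub> v \<Longrightarrow> v \<rightarrow>\<^bsub>G\<^esub> u"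
proof -
  interpret graph G by (rule graph)
  show "u \<rightarrow>\<^bsub>G\<^esub> v \<Longrightarrow> v \<rightarrow>\<^bsub>G\<^esub> u" using sym_arcs by (auto simp: symmetric_def dest: symD)
qed

lemma finite_verts: "finite (verts G)"
proof -
  interpret graph G by (rule graph)
  show ?thesis by simp
qed

lemma sub_verts: "A \<subseteq> verts G" "B \<subseteq> verts G"
  using indep by (auto simp: independent_set_def)

lemma finite: "finite A" "finite B"
  using sub_verts finite_verts by (auto intro: finite_subset)

text \<open>Otherwise every vertex of \<open>W\<close> has two neighbours in \<open>W\<close>, and
  the resulting chordless cycle is an even hole. A vertex without neighbours in \<open>W\<close>
  also qualifies, with \<open>u\<close> arbitrary.\<close>

lemma exists_leaf:
  assumes W: "W \<subseteq> (A - B) \<union> (B - A)" "W \<noteq> {}"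
  obtains v u where "v \<in> W" "\<And>w. w \<in> W \<Longrightarrow> v \<rightarrow>\<^bsub>G\<^esub> w \<Longrightarrow> w = u"
proof (rule ccontr)
  let ?H = "piran_graph G A B"
  let ?E = "\<lambda>u v. u \<rightarrow>\<^bsub>?H\<^esub> v"
  note leaf = that
  assume "\<not> thesis"
  then have deg: "\<exists>w\<in>W. ?E v w \<and> w \<noteq> u" if "v \<in> W" for v u
    using that W leaf[of v u] unfolding dominates_piran_graph by auto
  have sym: "symp ?E" by (rule sympI) (auto simp: dominates_piran_graph dest: dominates_sym)
  have irrefl: "\<not> ?E x x" for x using piran_graph_bipartite[OF indep, of x x] by auto
  have "finite W" using W finite by (auto intro: finite_subset)
  then obtain u xs where C: "induced_path ?E xs" "set xs \<subseteq> W" "u \<in> W" "u \<notin> set xs" "2 \<le> length xs"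
    "?E u (hd xs)" "?E u (last xs)" and nbr: "\<forall>z\<in>set xs. ?E u z \<longrightarrow> z = hd xs \<or> z = last xs"
    by (rule chordless_cycle_exists[OF _ W(2) sym irrefl deg])
  let ?c = "u # xs @ [u]"
  have ne: "xs \<noteq> []" using C(5) by auto
  have arcs: "vwalk_arcs ?c = (u, hd xs) # vwalk_arcs xs @ [(last xs, u)]"
    using ne by (simp add: vwalk_arcs_append)
  have ends: "set (vwalk_arcs ?c) \<subseteq> {(a, b). ?E a b}"
    unfolding arcs using C induced_path_arcs[OF C(1)] sympD[OF sym] by auto
  have "set (vwalk_arcs ?c) \<subseteq> {(a, b). a \<in> A \<longleftrightarrow> b \<notin> A}"
    using ends piran_graph_bipartite[OF indep] by blast
  from alternating_walk[OF this] have "even (length xs + 1)" by simp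
  \<comment> \<open>The construction gives at least three vertices; evenness excludes three. The
    list \<open>?c\<close> has one entry more than the cycle has vertices.\<close>
  then have len: "5 \<le> length ?c" "even (length ?c - 1)" using C(5) by (auto; presburger)+
  have "verts ?H = (A - B) \<union> (B - A)" by (simp add: piran_graph_def)
  then have "vwalk ?c ?H" unfolding vwalk_def using ends C W by auto
  moreover have "distinct (tl ?c)" using C induced_path_distinct[OF C(1)] by simp
  moreover have "(a, b) \<in> set (vwalk_arcs ?c) \<or> (b, a) \<in> set (vwalk_arcs ?c)"
    if ab: "a \<in> set ?c" "b \<in> set ?c" "?E a b" for a b
  proof -
    consider "a \<in> set xs" "b \<in> set xs" | "a = u" "b \<in> set xs" | "b = u" "a \<in> set xs"
      using ab irrefl by auto
    then show ?thesis
    proof cases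
      case 1
      then show ?thesis using induced_path_edges[OF C(1) sym irrefl _ _ ab(3)] arcs by auto
    qed (use arcs nbr ab sympD[OF sym] in auto)
  qed
  ultimately obtain p where "hole ?H p" "length p = length ?c - 1"
    using hole_of_closed_walk[of ?c ?H] len(1) by auto
  then show False using hole_free len(2) unfolding even_hole_free_def by auto
qed

text \<open>Deleting a vertex with at most one neighbour loses one vertex and at most one edge, and
  a single vertex carries no edge, whence the strictness. The sides are merged into one set
  \<open>W\<close> because the deleted vertex may lie on either.\<close>

lemma card_edges:
  assumes "R \<subseteq> A - B" "S \<subseteq> B - A" "R \<union> S \<noteq> {}"
  shows "card {(x, y) \<in> R \<times> S. x \<rightarrow>\<^bsub>G\<^esub> y} < card R + card S"
proof -
  have "card {(x, y) \<in> (W \<inter> A) \<times> (W \<inter> B). x \<rightarrow>\<^bsub>G\<^esub> y} < card W"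
    if "finite W" "W \<subseteq> (A - B) \<union> (B - A)" "W \<noteq> {}" for W
    using that
  proof (induction "card W" arbitrary: W rule: less_induct)
    case less
    let ?e = "\<lambda>W. {(x, y) \<in> (W \<inter> A) \<times> (W \<inter> B). x \<rightarrow>\<^bsub>G\<^esub> y}"
    obtain v u where v: "v \<in> W" "\<And>w. w \<in> W \<Longrightarrow> v \<rightarrow>\<^bsub>G\<^esub> w \<Longrightarrow> w = u"
      using exists_leaf less.prems by metis
    \<comment> \<open>Pairs run from \<open>A\<close> to \<open>B\<close>, so the only edge that can
      disappear is \<open>(v, u)\<close> or \<open>(u, v)\<close>, depending on the side of
      \<open>v\<close>.\<close>
    have "\<exists>p. ?e W \<subseteq> insert p (?e (W - {v}))"
    proof (cases "v \<in> A")
      case True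
      then show ?thesis using v less.prems by (intro exI[of _ "(v, u)"]) auto
    next
      case False
      then show ?thesis using v less.prems dominates_sym by (intro exI[of _ "(u, v)"]) auto
    qed
    then obtain p where p: "?e W \<subseteq> insert p (?e (W - {v}))" ..
    have fin: "finite (?e W)" for W
      by (rule finite_subset[of _ "A \<times> B"]) (auto simp: finite)
    show ?case
    proof (cases "W - {v} = {}")
      case True
      then have "?e W = {}" using less.prems by auto
      then have "card (?e W) = 0" by (simp only: card.empty)
      then show ?thesis using less.prems(1,3) by (simp add: card_gt_0_iff)
    next
      case False
      have "card (?e W) \<le> Suc (card (?e (W - {v})))"
        using card_mono[OF _ p] fin[of "W - {v}"] by (simp add: card_insert_if split: if_splits)
      moreover have "card (W - {v}) < card W" using less.prems(1) v(1) by (rule card_Diff1_less)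
      moreover have "card (?e (W - {v})) < card (W - {v})"
        using less.hyps[of "W - {v}"] calculation(2) less.prems False by auto
      ultimately show ?thesis by linarith
    qed
  qed
  from this[of "R \<union> S"] have "card {(x, y) \<in> ((R \<union> S) \<inter> A) \<times> ((R \<union> S) \<inter> B). x \<rightarrow>\<^bsub>G\<^esub> y} < card (R \<union> S)"
    using assms finite by (auto dest: finite_subset[of R] finite_subset[of S])
  moreover have "(R \<union> S) \<inter> A = R" "(R \<union> S) \<inter> B = S" using assms by auto
  ultimately show ?thesis using card_Un_le[of R S] by simp
qed

end

section \<open>Peeling and token jumping\<close>

text \<open>An elimination order: when its turn comes, a target may be blocked only by its partner.
  The remainders \<open>R\<close> and \<open>S\<close> are parameters so that the unfinished runs of
  the algorithm, which append moves at the end, are peelings too.\<close>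

primrec peeling :: "('a \<Rightarrow> 'a \<Rightarrow> bool) \<Rightarrow> 'a set \<Rightarrow> 'a set \<Rightarrow> ('a \<times> 'a) list \<Rightarrow> 'a set \<Rightarrow> 'a set \<Rightarrow> bool"
where
  "peeling E X Y [] R S \<longleftrightarrow> R = X \<and> S = Y"
| "peeling E X Y (m # ms) R S \<longleftrightarrow> fst m \<in> X \<and> snd m \<in> Y \<and> (\<forall>x\<in>X. E x (snd m) \<longrightarrow> x = fst m) \<and>
     peeling E (X - {fst m}) (Y - {snd m}) ms R S"

lemma peeling_snoc:
  assumes "peeling E X Y ms R S" "x \<in> R" "y \<in> S" "\<And>z. z \<in> R \<Longrightarrow> E z y \<Longrightarrow> z = x"
  shows "peeling E X Y (ms @ [(x, y)]) (R - {x}) (S - {y})"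
  using assms by (induction ms arbitrary: X Y) auto

lemma peeling_remainder:
  "peeling E X Y ms R S \<Longrightarrow> R = X - fst ` set ms \<and> S = Y - snd ` set ms"
proof (induction ms arbitrary: X Y)
  case (Cons m ms)
  then have "R = X - {fst m} - fst ` set ms \<and> S = Y - {snd m} - snd ` set ms"
    unfolding peeling.simps by blast
  then show ?case by auto
qed simp

lemma peeling_moves_subset:
  "peeling E X Y ms R S \<Longrightarrow> fst ` set ms \<subseteq> X \<and> snd ` set ms \<subseteq> Y"
  by (induction ms arbitrary: X Y) fastforce+

lemma peeling_card:
  "peeling E X Y ms R S \<Longrightarrow> finite X \<Longrightarrow> finite Y \<Longrightarrow>
     card X = card R + length ms \<and> card Y = card S + length ms"
proof (induction ms arbitrary: X Y)
  case (Cons m ms)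
  then have "card (X - {fst m}) = card R + length ms \<and> card (Y - {snd m}) = card S + length ms"
    by (metis finite_Diff peeling.simps(2))
  then show ?case using Cons.prems card_Suc_Diff1[of X "fst m"] card_Suc_Diff1[of Y "snd m"] by auto
qed simp

section \<open>Token sets and the length of TJ-walks\<close>

lemma length_token_sets [simp]: "length (token_sets S ms) = Suc (length ms)"
  by (induction ms arbitrary: S) auto

lemma hd_token_sets [simp]: "hd (token_sets S ms) = S"
  by (cases ms) auto

lemma token_sets_not_Nil [simp]: "token_sets S ms \<noteq> []"
  by (cases ms) auto

text \<open>Tokens only ever enter \<open>B\<close>, so the part outside \<open>B\<close> shrinks. A
  token set that still holds the departing token therefore never recurs, which gives the
  distinctness required of a path.\<close>

lemma token_sets_diff_subset:
  "T \<in> set (token_sets S ms) \<Longrightarrow> snd ` set ms \<subseteq> B \<Longrightarrow> T - B \<subseteq> S - B"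
proof (induction ms arbitrary: S)
  case (Cons m ms)
  then show ?case by (cases "T = S") fastforce+
qed simp

text \<open>The final set stays fixed in the induction, and the first move brings at most one vertex
  of \<open>S\<close> into line with it. The inequality is strict because \<open>length\<close>
  counts token sets and not moves.\<close>

lemma TJ_walk_length:
  assumes "vwalk Q (with_proj (TJ_graph G))" "finite (verts G)"
  shows "card (hd Q - last Q) < length Q"
  using assms(1)
proof (induction rule: vwalk_induct)
  case (Cons S T es)
  let ?B = "last (T # es)"
  obtain u v where T: "T = insert v (S - {u})" and "independent_set G T"
    using Cons(1) by (auto simp: TJ_graph_def)
  then have "finite (T - ?B)" using assms(2) by (auto simp: independent_set_def intro: finite_subset)
  have "card (S - ?B) \<le> card (insert u (T - ?B))"
    by (rule card_mono) (use T \<open>finite (T - ?B)\<close> in auto)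
  also have "\<dots> \<le> Suc (card (T - ?B))" by (rule card_insert_le_m1) auto
  finally show ?case using Cons(2) by simp
qed simp

section \<open>Existence of peelings and the paths they describe\<close>

context piran_forest
begin

lemma indegree_sum:
  assumes "finite R" "finite S"
  shows "(\<Sum>y\<in>S. card {x\<in>R. x \<rightarrow>\<^bsub>G\<^esub> y}) = card {(x, y) \<in> R \<times> S. x \<rightarrow>\<^bsub>G\<^esub> y}"
proof -
  have "{(x, y) \<in> R \<times> S. x \<rightarrow>\<^bsub>G\<^esub> y} = prod.swap ` (SIGMA y:S. {x\<in>R. x \<rightarrow>\<^bsub>G\<^esub> y})" by force
  then show ?thesis using assms by (simp add: card_image)
qed

lemma outdegree_sum:
  assumes "finite R" "finite S"
  shows "(\<Sum>x\<in>R. card {y\<in>S. x \<rightarrow>\<^bsub>G\<^esub> y}) = card {(x, y) \<in> R \<times> S. x \<rightarrow>\<^bsub>G\<^esub> y}"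
proof -
  have "{(x, y) \<in> R \<times> S. x \<rightarrow>\<^bsub>G\<^esub> y} = (SIGMA x:R. {y\<in>S. x \<rightarrow>\<^bsub>G\<^esub> y})" by force
  then show ?thesis using assms by simp
qed

text \<open>Degrees of at least two on \<open>S\<close> would give
  \<open>2 * card S = card R + card S\<close> edges, against the strict bound. Arbitrary balanced
  remainders are allowed so that the same fact shows that the queue cannot run empty too
  early.\<close>

lemma exists_low_degree:
  assumes "R \<subseteq> A - B" "S \<subseteq> B - A" "card R = card S" "S \<noteq> {}"
  shows "\<exists>y\<in>S. card {x\<in>R. x \<rightarrow>\<^bsub>G\<^esub> y} \<le> 1"
proof (rule ccontr)
  assume "\<not> ?thesis"
  then have "2 \<le> card {x\<in>R. x \<rightarrow>\<^bsub>G\<^esub> y}" if "y \<in> S" for y using that by fastforce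
  then have "card S * 2 \<le> (\<Sum>y\<in>S. card {x\<in>R. x \<rightarrow>\<^bsub>G\<^esub> y})"
    using sum_bounded_below[of S "2::nat"] by fastforce
  also have "\<dots> < card R + card S"
    using indegree_sum[of R S] card_edges[of R S] assms finite finite_subset by fastforce
  finally show False using assms by simp
qed

lemma exists_peeling:
  assumes "R \<subseteq> A - B" "S \<subseteq> B - A" "card R = card S"
  obtains ms where "peeling (dominates G) R S ms {} {}"
proof -
  have "\<exists>ms. peeling (dominates G) R S ms {} {}"
    using assms
  proof (induction "card R" arbitrary: R S)
    case 0
    moreover have "finite R" "finite S" using 0 finite by (auto intro: finite_subset)
    ultimately have "R = {}" "S = {}" by auto
    then show ?case by (intro exI[of _ "[]"]) simp
  next
    case (Suc n)
    have fin: "finite R" "finite S" using Suc.prems finite by (auto intro: finite_subset)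
    have "S \<noteq> {}" using Suc by auto
    then obtain y where y: "y \<in> S" "card {x\<in>R. x \<rightarrow>\<^bsub>G\<^esub> y} \<le> 1"
      using exists_low_degree Suc.prems by blast
    \<comment> \<open>An unblocked \<open>y\<close> may take any partner, and one exists because
      \<open>card R\<close> is positive.\<close>
    have "\<exists>x\<in>R. {x\<in>R. x \<rightarrow>\<^bsub>G\<^esub> y} \<subseteq> {x}"
    proof (cases "{x\<in>R. x \<rightarrow>\<^bsub>G\<^esub> y} = {}")
      case True
      moreover have "R \<noteq> {}" using Suc by auto
      ultimately show ?thesis by auto
    next
      case False
      then have "card {x\<in>R. x \<rightarrow>\<^bsub>G\<^esub> y} \<noteq> 0" using fin by simp
      then have "card {x\<in>R. x \<rightarrow>\<^bsub>G\<^esub> y} = 1" using y(2) by linarith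
      then obtain x where "{x\<in>R. x \<rightarrow>\<^bsub>G\<^esub> y} = {x}" by (auto simp: card_1_singleton_iff)
      then show ?thesis by blast
    qed
    then obtain x where x: "x \<in> R" "\<And>z. z \<in> R \<Longrightarrow> z \<rightarrow>\<^bsub>G\<^esub> y \<Longrightarrow> z = x" by blast
    have "n = card (R - {x})" "card (R - {x}) = card (S - {y})"
      using Suc.hyps(2) Suc.prems(3) x y fin by auto
    then obtain ms where "peeling (dominates G) (R - {x}) (S - {y}) ms {} {}"
      using Suc.hyps(1)[of "R - {x}" "S - {y}"] Suc.prems by blast
    then show ?case using x y by (intro exI[of _ "(x, y) # ms"]) auto
  qed
  then show ?thesis using that by blast
qed

text \<open>The induction replaces \<open>A\<close> by the current token set \<open>S\<close>, whose
  two differences with \<open>B\<close> are exactly what remains to be peeled.\<close>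

lemma peeling_TJ_walk:
  assumes "independent_set G S" "peeling (dominates G) (S - B) (B - S) ms {} {}"
  shows "vpath (token_sets S ms) (with_proj (TJ_graph G)) \<and> last (token_sets S ms) = B"
  using assms
proof (induction ms arbitrary: S)
  case Nil
  then have "S = B" by auto
  then show ?case using Nil by (auto simp: vpath_def vwalk_def TJ_graph_def)
next
  case (Cons m ms)
  obtain x y where m: "m = (x, y)" by (cases m)
  let ?T = "insert y (S - {x})"
  have xy: "x \<in> S - B" "y \<in> B - S" "\<And>z. z \<in> S - B \<Longrightarrow> z \<rightarrow>\<^bsub>G\<^esub> y \<Longrightarrow> z = x"
    and peel: "peeling (dominates G) (S - B - {x}) (B - S - {y}) ms {} {}"
    using Cons.prems m by auto
  \<comment> \<open>A token on \<open>B\<close> cannot block \<open>y\<close>, since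
    \<open>B\<close> is independent; outside \<open>B\<close> only the departing token on
    \<open>x\<close> could.\<close>
  have "\<not> z \<rightarrow>\<^bsub>G\<^esub> y" if "z \<in> ?T" for z
    using that xy indep(2) unfolding independent_set_def by blast
  then have T: "independent_set G ?T"
    using Cons.prems(1) xy sub_verts dominates_sym unfolding independent_set_def by blast
  have "?T - B = S - B - {x}" "B - ?T = B - S - {y}" using xy by auto
  then have IH: "vpath (token_sets ?T ms) (with_proj (TJ_graph G))" "last (token_sets ?T ms) = B"
    using Cons.IH[OF T] peel by auto
  have "(S, ?T) \<in> parcs (TJ_graph G)"
    using Cons.prems(1) T xy(1,2) sub_verts unfolding TJ_graph_def by auto
  moreover have S: "S \<in> pverts (TJ_graph G)" using Cons.prems(1) by (simp add: TJ_graph_def)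
  ultimately have "vwalk (token_sets S (m # ms)) (with_proj (TJ_graph G))"
    using IH(1) m vwalk_consI[of "token_sets ?T ms" "with_proj (TJ_graph G)" S] S
    by (simp add: vpath_def)
  moreover have "S \<notin> set (token_sets ?T ms)"
    using token_sets_diff_subset[of S ?T ms B] peeling_moves_subset[OF peel] xy by blast
  ultimately show ?case using IH m by (auto simp: vpath_def)
qed

lemma peeling_shortest_TJ_path:
  assumes "peeling (dominates G) (A - B) (B - A) ms {} {}"
  shows "shortest_TJ_path G A B (token_sets A ms)"
proof -
  have "TJ_path G A B (token_sets A ms)"
    using peeling_TJ_walk[OF indep(1) assms] by (simp add: TJ_path_def)
  \<comment> \<open>The peeling has \<open>card (A - B)\<close> moves, which is the lower bound for
    every walk from \<open>A\<close> to \<open>B\<close>.\<close>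
  moreover have "length ms < length Q" if "TJ_path G A B Q" for Q
    using TJ_walk_length[OF _ finite_verts, of Q] that peeling_card[OF assms] finite
    by (auto simp: TJ_path_def vpath_def)
  ultimately show ?thesis unfolding shortest_TJ_path_def by fastforce
qed

lemma card_diff_eq: "card (A - B) = card (B - A)"
proof -
  have "card (A - B) = card A - card (A \<inter> B)" "card (B - A) = card B - card (A \<inter> B)"
    using finite by (simp_all add: card_Diff_subset_Int Int_commute)
  then show ?thesis using card_eq by simp
qed

lemma TJ_reconfigurable: "TJ_reconfigurable G A B"
proof -
  obtain ms where "peeling (dominates G) (A - B) (B - A) ms {} {}"
    using exists_peeling[of "A - B" "B - A"] card_diff_eq by blast
  then have walk: "vwalk (token_sets A ms) (with_proj (TJ_graph G))" "last (token_sets A ms) = B"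
    using peeling_TJ_walk[OF indep(1)] by (auto simp: vpath_def)
  have "hd Q \<rightarrow>\<^sup>*\<^bsub>with_proj (TJ_graph G)\<^esub> last Q" if "vwalk Q (with_proj (TJ_graph G))" for Q
    using that
  proof (induction rule: vwalk_induct)
    case (Cons S T es)
    moreover have "S \<in> pverts (TJ_graph G)" using Cons(1) by (auto simp: TJ_graph_def)
    ultimately show ?case
      by (auto simp: reachable_def intro: converse_rtrancl_on_into_rtrancl_on)
  qed (simp add: reachable_def)
  from this[OF walk(1)] show ?thesis unfolding TJ_reconfigurable_def using walk(2) by simp
qed

end

section \<open>Running times\<close>

inductive_cases runs_SkipE: "runs Skip s t s'"
inductive_cases runs_Set_RegE: "runs (Set_Reg x e) s t s'"
inductive_cases runs_Set_CellE: "runs (Set_Cell a e f) s t s'"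
inductive_cases runs_SeqE: "runs (Seq c d) s t s'"
inductive_cases runs_CondE: "runs (Cond b c d) s t s'"

text \<open>
  A precondition calculus with time credits: \<open>k\<close> is the credit available in \<open>s\<close>, and the postcondition
  receives the unused rest.
\<close>

definition wp :: "com \<Rightarrow> (memory \<Rightarrow> nat \<Rightarrow> bool) \<Rightarrow> memory \<Rightarrow> nat \<Rightarrow> bool" where
  "wp c Q s k \<longleftrightarrow> (\<exists>t s'. runs c s t s' \<and> t \<le> k \<and> Q s' (k - t))"

lemma wp_Skip: "wp Skip Q s k \<longleftrightarrow> 1 \<le> k \<and> Q s (k - 1)"
  unfolding wp_def by (metis runs.Skip runs_SkipE)

lemma wp_Set_Reg: "wp (Set_Reg x e) Q s k \<longleftrightarrow>
    1 + acost e \<le> k \<and> Q (s\<lparr>reg := (reg s)(x := aval e s)\<rparr>) (k - (1 + acost e))"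
  unfolding wp_def by (metis runs.Set_Reg runs_Set_RegE)

lemma wp_Set_Cell: "wp (Set_Cell a e f) Q s k \<longleftrightarrow>
    1 + acost e + acost f \<le> k \<and>
    Q (s\<lparr>cell := (cell s)(a := (cell s a)(aval e s := aval f s))\<rparr>) (k - (1 + acost e + acost f))"
  unfolding wp_def by (metis runs.Set_Cell runs_Set_CellE)

lemma wp_Seq: "wp (Seq c d) Q s k \<longleftrightarrow> 1 \<le> k \<and> wp c (wp d Q) s (k - 1)"
proof
  assume "wp (Seq c d) Q s k"
  then obtain t u s' s'' where r: "runs c s t s'" "runs d s' u s''" "1 + t + u \<le> k" "Q s'' (k - (1 + t + u))"
    unfolding wp_def by (auto elim!: runs_SeqE)
  have "k - (1 + t + u) = k - 1 - t - u" by simp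
  with r have "wp d Q s' (k - 1 - t)" unfolding wp_def by (intro exI[of _ u] exI[of _ s'']) auto
  with r show "1 \<le> k \<and> wp c (wp d Q) s (k - 1)"
    unfolding wp_def[of c] by (auto intro!: exI[of _ t] exI[of _ s'])
next
  assume "1 \<le> k \<and> wp c (wp d Q) s (k - 1)"
  then obtain t u s' s'' where r: "runs c s t s'" "runs d s' u s''" "1 \<le> k" "t \<le> k - 1"
    "u \<le> k - 1 - t" "Q s'' (k - 1 - t - u)"
    unfolding wp_def by auto
  have "k - (1 + t + u) = k - 1 - t - u" by simp
  with r runs.Seq[OF r(1,2)] show "wp (Seq c d) Q s k"
    unfolding wp_def by (intro exI[of _ "1 + t + u"] exI[of _ s'']) auto
qed

lemma wp_Cond: "wp (Cond b c d) Q s k \<longleftrightarrow>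
    1 + bcost b \<le> k \<and> wp (if bval b s then c else d) Q s (k - (1 + bcost b))"
proof
  assume "wp (Cond b c d) Q s k"
  then obtain t s' where "runs (if bval b s then c else d) s t s'" "1 + bcost b + t \<le> k"
    "Q s' (k - (1 + bcost b + t))"
    unfolding wp_def by (auto elim!: runs_CondE)
  then show "1 + bcost b \<le> k \<and> wp (if bval b s then c else d) Q s (k - (1 + bcost b))"
    unfolding wp_def by (auto intro!: exI[of _ t] exI[of _ s'])
next
  assume "1 + bcost b \<le> k \<and> wp (if bval b s then c else d) Q s (k - (1 + bcost b))"
  then obtain t s' where r: "runs (if bval b s then c else d) s t s'" "1 + bcost b \<le> k"
    "t \<le> k - (1 + bcost b)" "Q s' (k - (1 + bcost b) - t)"
    unfolding wp_def by auto
  have "runs (Cond b c d) s (1 + bcost b + t) s'"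
    using r(1) runs.Cond_True[of b s c t s' d] runs.Cond_False[of b s d t s' c] by (simp split: if_splits)
  with r show "wp (Cond b c d) Q s k"
    unfolding wp_def by (intro exI[of _ "1 + bcost b + t"] exI[of _ s']) auto
qed

lemma wp_mono:
  assumes "wp c P s k" "\<And>s' k'. P s' k' \<Longrightarrow> Q s' k'"
  shows "wp c Q s k"
  using assms unfolding wp_def by blast

text \<open>Every iteration uses up credit, so no variant is needed for termination.\<close>

lemma wp_Loop:
  assumes "I s k"
    and step: "\<And>s k. I s k \<Longrightarrow> bval b s \<Longrightarrow> 1 + bcost b \<le> k \<and> wp c I s (k - (1 + bcost b))"
    and exit: "\<And>s k. I s k \<Longrightarrow> \<not> bval b s \<Longrightarrow> 1 + bcost b \<le> k \<and> Q s (k - (1 + bcost b))"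
  shows "wp (Loop b c) Q s k"
  using assms(1)
proof (induction k arbitrary: s rule: less_induct)
  case (less k)
  show ?case
  proof (cases "bval b s")
    case False
    then show ?thesis using exit[OF less.prems] runs.Loop_False unfolding wp_def by blast
  next
    case True
    then obtain t s' where r: "runs c s t s'" "1 + bcost b \<le> k" "t \<le> k - (1 + bcost b)"
      "I s' (k - (1 + bcost b) - t)"
      using step[OF less.prems] unfolding wp_def by auto
    then obtain u s'' where u: "runs (Loop b c) s' u s''" "u \<le> k - (1 + bcost b) - t"
      "Q s'' (k - (1 + bcost b) - t - u)"
      using less.IH[of "k - (1 + bcost b) - t" s'] unfolding wp_def by auto
    have "k - (1 + bcost b) - t - u = k - (1 + bcost b + t + u)" by simp
    then show ?thesis
      using runs.Loop_True[OF True r(1) u(1)] r u unfolding wp_def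
      by (intro exI[of _ "1 + bcost b + t + u"] exI[of _ s'']) auto
  qed
qed

lemmas wp_simps = wp_Skip wp_Set_Reg wp_Set_Cell wp_Seq wp_Cond

section \<open>The algorithm\<close>

definition incr :: "string \<Rightarrow> com" where
  "incr r = Set_Reg r (Add (Reg r) (Num 1))"

definition mark :: "string \<Rightarrow> nat \<Rightarrow> com" where
  "mark a m = Seq (Set_Reg ''i'' (Num 0)) (Loop (Lt (Reg ''i'') (Reg ''size''))
     (Seq (Set_Cell ''on'' (Cell a (Reg ''i'')) (Num m)) (incr ''i'')))"

definition push :: com where
  "push = Seq (Set_Cell ''to'' (Reg ''tl'') (Reg ''y'')) (incr ''tl'')"

text \<open>The marks serve as a constant-time membership test for \<open>A\<close>: an unmarked
  \<open>y\<close> lies in \<open>B - A\<close> and receives its counter, a marked one lies in both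
  sets and loses its mark.\<close>

definition init :: com where
  "init = Seq (Set_Reg ''tl'' (Num 0)) (Seq (Set_Reg ''i'' (Num 0)) (Loop (Lt (Reg ''i'') (Reg ''size''))
     (Seq (Set_Reg ''y'' (Cell ''B'' (Reg ''i'')))
     (Seq (Cond (Lt (Cell ''on'' (Reg ''y'')) (Num 1))
            (Seq (Set_Cell ''d'' (Reg ''y'') (Cell ''deg'' (Reg ''y'')))
                 (Cond (Lt (Cell ''d'' (Reg ''y'')) (Num 2)) push Skip))
            (Set_Cell ''on'' (Reg ''y'') (Num 0)))
     (incr ''i'')))))"

definition neighbour :: "string \<Rightarrow> aexp" where
  "neighbour r = Cell ''adj'' (Add (Cell ''start'' (Reg r)) (Reg ''i''))"

text \<open>There is no bounds check: as long as a marked vertex remains at or after index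
  \<open>p\<close>, it stops the search.\<close>

definition advance :: com where
  "advance = Loop (Lt (Cell ''on'' (Cell ''A'' (Reg ''p''))) (Num 1)) (incr ''p'')"

text \<open>On entry \<open>x\<close> holds the vertex found by \<open>advance\<close>; it survives
  as the default source if \<open>y\<close> has no marked neighbour.\<close>

definition scan :: com where
  "scan = Seq (Set_Reg ''i'' (Num 0)) (Loop (Lt (Reg ''i'') (Cell ''deg'' (Reg ''y'')))
     (Seq (Cond (Lt (Num 0) (Cell ''on'' (neighbour ''y''))) (Set_Reg ''x'' (neighbour ''y'')) Skip)
     (incr ''i'')))"

text \<open>A vertex is pushed exactly when its counter drops from two to one. At zero it is already
  in the array, so nothing is queued twice.\<close>

definition update :: com where
  "update = Seq (Set_Reg ''i'' (Num 0)) (Loop (Lt (Reg ''i'') (Cell ''deg'' (Reg ''x'')))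
     (Seq (Set_Reg ''y'' (neighbour ''x''))
     (Seq (Set_Cell ''d'' (Reg ''y'') (Sub (Cell ''d'' (Reg ''y'')) (Num 1)))
     (Seq (Cond (Conj (Lt (Num 0) (Cell ''d'' (Reg ''y''))) (Lt (Cell ''d'' (Reg ''y'')) (Num 2))) push Skip)
     (incr ''i'')))))"

definition move :: com where
  "move = Seq (Set_Reg ''y'' (Cell ''to'' (Reg ''moves'')))
     (Seq advance
     (Seq (Set_Reg ''x'' (Cell ''A'' (Reg ''p'')))
     (Seq scan
     (Seq (Set_Cell ''from'' (Reg ''moves'') (Reg ''x''))
     (Seq (Set_Cell ''on'' (Reg ''x'') (Num 0))
     (Seq (incr ''moves'') update))))))"

text \<open>
  The array \<open>to\<close> is at the same time the queue, of which \<open>to[moves]\<close> is the head and \<open>tl\<close> the end: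
  its entries never have to be removed because every vertex leaving the queue is the target of the
  next move. The array \<open>on\<close> marks the remaining vertices of \<open>A - B\<close>; \<open>p\<close> is a lower bound for the
  index in \<open>A\<close> of a marked vertex.
\<close>

definition reconfigure :: com where
  "reconfigure = Seq (mark ''B'' 0) (Seq (mark ''A'' 1) (Seq init
     (Seq (Set_Reg ''moves'' (Num 0)) (Seq (Set_Reg ''p'' (Num 0))
     (Loop (Lt (Reg ''moves'') (Reg ''tl'')) move)))))"

lemma bij_betw_push:
  assumes "bij_betw f {..<t} S" "w \<notin> S"
  shows "bij_betw (f(t := w)) {..<Suc t} (insert w S)"
proof -
  have "bij_betw (f(t := w)) {..<t} S"
    using assms(1) by (subst bij_betw_cong[of _ _ f]) auto
  then have "bij_betw (f(t := w)) ({..<t} \<union> {t}) (S \<union> {(f(t := w)) t})"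
    using assms(2) by (subst notIn_Un_bij_betw3[symmetric]) auto
  then show ?thesis by (simp add: lessThan_Suc)
qed

lemma bij_betw_target_cong: "bij_betw f S T \<Longrightarrow> T = T' \<Longrightarrow> bij_betw f S T'"
  by simp

section \<open>Reading the input, and the initialisation\<close>

locale piran_input = piran_forest G A B for G :: "(nat, 'b) pre_digraph" and A B +
  fixes s0 :: memory
  assumes input: "encodes_input G A B s0"
begin

abbreviation "n \<equiv> card A"
abbreviation "a \<equiv> cell s0 ''A''"
abbreviation "b \<equiv> cell s0 ''B''"
abbreviation "deg \<equiv> cell s0 ''deg''"
abbreviation "nbr v i \<equiv> cell s0 ''adj'' (cell s0 ''start'' v + i)"

text \<open>The abbreviations \<open>a\<close>, \<open>b\<close>, \<open>deg\<close> and
  \<open>nbr\<close> read the initial memory \<open>s0\<close>. As the program never writes to these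
  arrays, they describe every later state as well.\<close>

definition same_input :: "memory \<Rightarrow> bool" where
  "same_input s \<longleftrightarrow> reg s ''size'' = n \<and>
     (\<forall>r\<in>{''A'', ''B'', ''adj'', ''start'', ''deg''}. cell s r = cell s0 r)"

lemma same_input_start: "same_input s0"
  using input by (simp add: same_input_def encodes_input_def)

lemma bij_a: "bij_betw a {..<n} A" and bij_b: "bij_betw b {..<n} B"
  using input card_eq by (simp_all add: encodes_input_def)

lemma bij_nbr: "v \<in> (A - B) \<union> (B - A) \<Longrightarrow> bij_betw (nbr v) {..<deg v} {w. v \<rightarrow>\<^bsub>piran_graph G A B\<^esub> w}"
  using input by (auto simp: encodes_input_def piran_graph_def)

lemma piran_nbrs_A: "x \<in> A - B \<Longrightarrow> {w. x \<rightarrow>\<^bsub>piran_graph G A B\<^esub> w} = {y\<in>B - A. x \<rightarrow>\<^bsub>G\<^esub> y}"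
  using indep by (auto simp: dominates_piran_graph independent_set_def)

lemma piran_nbrs_B: "y \<in> B - A \<Longrightarrow> {w. y \<rightarrow>\<^bsub>piran_graph G A B\<^esub> w} = {x\<in>A - B. x \<rightarrow>\<^bsub>G\<^esub> y}"
  using indep dominates_sym by (auto simp: dominates_piran_graph independent_set_def)

lemma bij_nbr_A: "x \<in> A - B \<Longrightarrow> bij_betw (nbr x) {..<deg x} {y\<in>B - A. x \<rightarrow>\<^bsub>G\<^esub> y}"
  using bij_nbr[of x] by (simp only: piran_nbrs_A) simp

lemma bij_nbr_B: "y \<in> B - A \<Longrightarrow> bij_betw (nbr y) {..<deg y} {x\<in>A - B. x \<rightarrow>\<^bsub>G\<^esub> y}"
  using bij_nbr[of y] by (simp only: piran_nbrs_B) simp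

lemma deg_A: "x \<in> A - B \<Longrightarrow> deg x = card {y\<in>B - A. x \<rightarrow>\<^bsub>G\<^esub> y}"
  using bij_betw_same_card[OF bij_nbr_A] by simp

lemma deg_B: "y \<in> B - A \<Longrightarrow> deg y = card {x\<in>A - B. x \<rightarrow>\<^bsub>G\<^esub> y}"
  using bij_betw_same_card[OF bij_nbr_B] by simp

text \<open>Each sum counts the edges of the Piran graph from one side, so the edge bound pays for
  traversing all adjacency lists.\<close>

lemma sum_deg: "sum deg (A - B) \<le> 2 * n" "sum deg (B - A) \<le> 2 * n"
proof -
  have "card {(x, y) \<in> (A - B) \<times> (B - A). x \<rightarrow>\<^bsub>G\<^esub> y} \<le> card (A - B) + card (B - A)"
  proof (cases "(A - B) \<union> (B - A) = {}")
    case False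
    then show ?thesis using card_edges[of "A - B" "B - A"] by simp
  next
    case True
    then have "{(x, y) \<in> (A - B) \<times> (B - A). x \<rightarrow>\<^bsub>G\<^esub> y} = {}" by blast
    then show ?thesis by (simp only: card.empty le0)
  qed
  also have "\<dots> \<le> 2 * n" using card_diff_eq card_mono[of A "A - B"] finite by simp
  finally show "sum deg (A - B) \<le> 2 * n" "sum deg (B - A) \<le> 2 * n"
    using indegree_sum[of "A - B" "B - A"] outdegree_sum[of "A - B" "B - A"] finite
    by (simp_all add: deg_A deg_B)
qed

text \<open>\<open>K\<close> is the credit reserved for what follows. Constants are rounded up here
  and below: a pass costs 13 units and is charged 20, and the 10 in the invariant covers the failing
  guard.\<close>

lemma wp_mark_B:
  assumes "same_input s" "20 * n + 20 + K \<le> k"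
  shows "wp (mark ''B'' 0) (\<lambda>s k. same_input s \<and> (\<forall>v\<in>B. cell s ''on'' v = 0) \<and> K \<le> k) s k"
proof -
  let ?I = "\<lambda>s k. same_input s \<and> reg s ''i'' \<le> n \<and> (\<forall>v\<in>b ` {..<reg s ''i''}. cell s ''on'' v = 0) \<and>
    20 * (n - reg s ''i'') + 10 + K \<le> k"
  have "b ` {..<n} = B" using bij_b by (simp add: bij_betw_def)
  then show ?thesis
    unfolding mark_def incr_def using assms
    by (auto simp: wp_simps same_input_def lessThan_Suc intro!: wp_Loop[where I = ?I])
qed

text \<open>Memory is arbitrary at the start, so the vertices of \<open>B - A\<close> have definite
  marks only because \<open>B\<close> was cleared before.\<close>

lemma wp_mark_A:
  assumes "same_input s" "\<forall>v\<in>B. cell s ''on'' v = 0" "20 * n + 20 + K \<le> k"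
  shows "wp (mark ''A'' 1) (\<lambda>s k. same_input s \<and>
    (\<forall>v\<in>A \<union> B. cell s ''on'' v = of_bool (v \<in> A)) \<and> K \<le> k) s k"
proof -
  let ?I = "\<lambda>s k. same_input s \<and> reg s ''i'' \<le> n \<and>
    (\<forall>v\<in>a ` {..<reg s ''i''} \<union> B. cell s ''on'' v = of_bool (v \<in> a ` {..<reg s ''i''})) \<and>
    20 * (n - reg s ''i'') + 10 + K \<le> k"
  have "a ` {..<n} = A" using bij_a by (simp add: bij_betw_def)
  then show ?thesis
    unfolding mark_def incr_def using assms
    by (auto simp: wp_simps same_input_def lessThan_Suc intro!: wp_Loop[where I = ?I])
qed

lemma wp_init:
  assumes "same_input s" "\<forall>v\<in>A \<union> B. cell s ''on'' v = of_bool (v \<in> A)" "60 * n + 20 + K \<le> k"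
  shows "wp init (\<lambda>s k. same_input s \<and> (\<forall>v\<in>A \<union> B. cell s ''on'' v = of_bool (v \<in> A - B)) \<and>
    (\<forall>v\<in>B - A. cell s ''d'' v = deg v) \<and>
    bij_betw (cell s ''to'') {..<reg s ''tl''} {v\<in>B - A. cell s ''d'' v < 2} \<and> K \<le> k) s k"
proof -
  let ?seen = "\<lambda>s. b ` {..<reg s ''i''}"
  let ?I = "\<lambda>s k. same_input s \<and> reg s ''i'' \<le> n \<and>
    (\<forall>v\<in>A \<union> B. cell s ''on'' v = of_bool (v \<in> A - ?seen s)) \<and>
    (\<forall>v\<in>(B - A) \<inter> ?seen s. cell s ''d'' v = deg v) \<and>
    bij_betw (cell s ''to'') {..<reg s ''tl''} {v\<in>(B - A) \<inter> ?seen s. cell s ''d'' v < 2} \<and>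
    60 * (n - reg s ''i'') + 10 + K \<le> k"
  let ?body = "Seq (Set_Reg ''y'' (Cell ''B'' (Reg ''i'')))
     (Seq (Cond (Lt (Cell ''on'' (Reg ''y'')) (Num 1))
            (Seq (Set_Cell ''d'' (Reg ''y'') (Cell ''deg'' (Reg ''y'')))
                 (Cond (Lt (Cell ''d'' (Reg ''y'')) (Num 2)) push Skip))
            (Set_Cell ''on'' (Reg ''y'') (Num 0)))
     (incr ''i''))"
  have b: "b ` {..<n} = B" "inj_on b {..<n}" using bij_b by (simp_all add: bij_betw_def)
  have step: "wp ?body ?I s (k - (1 + bcost (Lt (Reg ''i'') (Reg ''size''))))" if I: "?I s k" and i: "reg s ''i'' < n" for s k
  proof -
    let ?y = "b (reg s ''i'')"
    \<comment> \<open>By injectivity of the listing \<open>?y\<close> is met for the first time: its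
      mark still decides \<open>?y \<in> A\<close>, and it is not yet queued.\<close>
    have y: "?y \<in> B" "?y \<notin> ?seen s"
      using b i by (auto simp: inj_on_def) (metis less_irrefl less_trans lessThan_iff)
    have y': "\<forall>j<reg s ''i''. b j \<noteq> ?y" using y(2) by (metis imageI lessThan_iff)
    have B: "cell s ''B'' = b" "cell s ''deg'' = deg" using I by (simp_all add: same_input_def)
    have k: "60 * (n - Suc (reg s ''i'')) + 70 + K \<le> k" using I i by auto
    have seen: "b ` {..<Suc (reg s ''i'')} = insert ?y (?seen s)" by (simp add: lessThan_Suc)
    show ?thesis
    proof (cases "?y \<in> A")
      case True
      have "{v \<in> (B - A) \<inter> insert ?y (?seen s). cell s ''d'' v < 2} =
        {v \<in> (B - A) \<inter> ?seen s. cell s ''d'' v < 2}" using True by auto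
      then have "bij_betw (cell s ''to'') {..<reg s ''tl''}
          {v \<in> (B - A) \<inter> insert ?y (?seen s). cell s ''d'' v < 2}"
        using I by argo
      note bij = bij_betw_target_cong[OF this]
      show ?thesis
        unfolding push_def incr_def using I i y k B True seen
        by (auto simp: wp_simps same_input_def intro!: bij)
    next
      case False
      let ?d = "(cell s ''d'')(?y := deg ?y)"
      let ?low = "{v \<in> (B - A) \<inter> insert ?y (?seen s). ?d v < 2}"
      show ?thesis
      proof (cases "deg ?y < 2")
        case True
        have "bij_betw ((cell s ''to'')(reg s ''tl'' := ?y)) {..<Suc (reg s ''tl'')}
          (insert ?y {v \<in> (B - A) \<inter> ?seen s. cell s ''d'' v < 2})"
          using I y by (intro bij_betw_push) auto
        note bij = bij_betw_target_cong[OF this]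
        show ?thesis
          unfolding push_def incr_def using I i y k B False True seen
          by (auto simp: wp_simps same_input_def intro!: bij)
      next
        case high: False
        have "bij_betw (cell s ''to'') {..<reg s ''tl''} {v \<in> (B - A) \<inter> ?seen s. cell s ''d'' v < 2}"
          using I by argo
        note bij = bij_betw_target_cong[OF this]
        show ?thesis
          unfolding push_def incr_def using I i y y' k B False high seen
          by (auto simp: wp_simps same_input_def intro!: bij)
      qed
    qed
  qed
  have "wp (Loop (Lt (Reg ''i'') (Reg ''size'')) ?body) (\<lambda>s k. same_input s \<and>
      (\<forall>v\<in>A \<union> B. cell s ''on'' v = of_bool (v \<in> A - B)) \<and> (\<forall>v\<in>B - A. cell s ''d'' v = deg v) \<and>
      bij_betw (cell s ''to'') {..<reg s ''tl''} {v\<in>B - A. cell s ''d'' v < 2} \<and> K \<le> k)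
    (s\<lparr>reg := (reg s)(''tl'' := 0, ''i'' := 0)\<rparr>) k'" if "60 * n + 10 + K \<le> k'" for k'
  proof (rule wp_Loop[where I = ?I])
    show "?I (s\<lparr>reg := (reg s)(''tl'' := 0, ''i'' := 0)\<rparr>) k'"
      using assms that by (auto simp: same_input_def bij_betw_def)
  next
    fix s k assume I: "?I s k" and "bval (Lt (Reg ''i'') (Reg ''size'')) s"
    then show "1 + bcost (Lt (Reg ''i'') (Reg ''size'')) \<le> k \<and>
      wp ?body ?I s (k - (1 + bcost (Lt (Reg ''i'') (Reg ''size''))))"
      using step[OF I] by (auto simp: same_input_def)
  next
    fix s k assume I: "?I s k" and "\<not> bval (Lt (Reg ''i'') (Reg ''size'')) s"
    then have "reg s ''i'' = n" by (auto simp: same_input_def)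
    then have "?seen s = B" using b by simp
    then show "1 + bcost (Lt (Reg ''i'') (Reg ''size'')) \<le> k \<and> same_input s \<and>
      (\<forall>v\<in>A \<union> B. cell s ''on'' v = of_bool (v \<in> A - B)) \<and> (\<forall>v\<in>B - A. cell s ''d'' v = deg v) \<and>
      bij_betw (cell s ''to'') {..<reg s ''tl''} {v\<in>B - A. cell s ''d'' v < 2} \<and>
      K \<le> k - (1 + bcost (Lt (Reg ''i'') (Reg ''size'')))"
      using I by (auto simp: Int_absorb2)
  qed
  then show ?thesis unfolding init_def wp_simps using assms(3) by auto
qed

section \<open>One move, its amortised cost, and the main loop\<close>

lemma wp_advance:
  assumes "same_input s" "\<forall>v\<in>A. cell s ''on'' v = of_bool (v \<in> R)" "R \<noteq> {}"
    "R \<subseteq> a ` {reg s ''p''..<n}" "20 * (n - reg s ''p'') + 20 + K \<le> k"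
    "\<And>p k. R \<subseteq> a ` {p..<n} \<Longrightarrow> p < n \<Longrightarrow> a p \<in> R \<Longrightarrow> 20 * (n - p) + K \<le> k \<Longrightarrow>
       Q (s\<lparr>reg := (reg s)(''p'' := p)\<rparr>) k"
  shows "wp advance Q s k"
proof -
  let ?I = "\<lambda>s' k. \<exists>p. s' = s\<lparr>reg := (reg s)(''p'' := p)\<rparr> \<and> R \<subseteq> a ` {p..<n} \<and> p < n \<and>
    20 * (n - p) + 20 + K \<le> k"
  have a: "a p \<in> A" if "p < n" for p using bij_a that by (auto simp: bij_betw_def)
  have A: "cell s ''A'' = a" using assms(1) by (simp add: same_input_def)
  have lt: "p < n" if "R \<subseteq> a ` {p..<n}" for p
    using that assms(3) by (cases "p < n") auto
  have next_p: "R \<subseteq> a ` {Suc p..<n}" if "R \<subseteq> a ` {p..<n}" "a p \<notin> R" "p < n" for p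
  proof -
    have "{p..<n} = insert p {Suc p..<n}" using that(3) by auto
    then show ?thesis using that by auto
  qed
  show ?thesis
    unfolding advance_def
  proof (rule wp_Loop[where I = ?I])
    show "?I s k" using assms lt by (intro exI[of _ "reg s ''p''"]) auto
  next
    fix s' k' assume I: "?I s' k'" and "bval (Lt (Cell ''on'' (Cell ''A'' (Reg ''p''))) (Num 1)) s'"
    then obtain p where p: "s' = s\<lparr>reg := (reg s)(''p'' := p)\<rparr>" "R \<subseteq> a ` {p..<n}" "p < n"
      "20 * (n - p) + 20 + K \<le> k'" "a p \<notin> R" using A assms(2) a by auto
    then have "R \<subseteq> a ` {Suc p..<n}" "Suc p < n" using next_p lt by blast+
    then show "1 + bcost (Lt (Cell ''on'' (Cell ''A'' (Reg ''p''))) (Num 1)) \<le> k' \<and>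
      wp (incr ''p'') ?I s' (k' - (1 + bcost (Lt (Cell ''on'' (Cell ''A'' (Reg ''p''))) (Num 1))))"
      using p by (auto simp: incr_def wp_simps intro!: exI[of _ "Suc p"])
  next
    fix s' k' assume I: "?I s' k'" and "\<not> bval (Lt (Cell ''on'' (Cell ''A'' (Reg ''p''))) (Num 1)) s'"
    then obtain p where p: "s' = s\<lparr>reg := (reg s)(''p'' := p)\<rparr>" "R \<subseteq> a ` {p..<n}" "p < n"
      "20 * (n - p) + 20 + K \<le> k'" "a p \<in> R" using A assms(2) a by (auto split: if_splits)
    then show "1 + bcost (Lt (Cell ''on'' (Cell ''A'' (Reg ''p''))) (Num 1)) \<le> k' \<and>
      Q s' (k' - (1 + bcost (Lt (Cell ''on'' (Cell ''A'' (Reg ''p''))) (Num 1))))"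
      using assms(6)[OF p(2,3,5)] by auto
  qed
qed

text \<open>The invariant says that all remaining neighbours read so far equal \<open>x\<close>. It
  holds vacuously for the default source, and \<open>y\<close> has at most one remaining
  neighbour.\<close>

lemma wp_scan:
  assumes "same_input s" "y \<in> B - A" "reg s ''y'' = y" "\<forall>v\<in>A. cell s ''on'' v = of_bool (v \<in> R)"
    "R \<subseteq> A - B" "reg s ''x'' \<in> R" "card {z\<in>R. z \<rightarrow>\<^bsub>G\<^esub> y} \<le> 1" "60 * deg y + 20 + K \<le> k"
    "\<And>x i k. x \<in> R \<Longrightarrow> \<forall>z\<in>R. z \<rightarrow>\<^bsub>G\<^esub> y \<longrightarrow> z = x \<Longrightarrow> K \<le> k \<Longrightarrow>
       Q (s\<lparr>reg := (reg s)(''x'' := x, ''i'' := i)\<rparr>) k"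
  shows "wp scan Q s k"
proof -
  define I where "I = (\<lambda>s' k. \<exists>x i. s' = s\<lparr>reg := (reg s)(''x'' := x, ''i'' := i)\<rparr> \<and> x \<in> R \<and> i \<le> deg y \<and>
    (\<forall>z\<in>nbr y ` {..<i} \<inter> R. z = x) \<and> 60 * (deg y - i) + 10 + K \<le> k)"
  let ?body = "Seq (Cond (Lt (Num 0) (Cell ''on'' (neighbour ''y''))) (Set_Reg ''x'' (neighbour ''y'')) Skip)
     (incr ''i'')"
  have inp: "cell s ''adj'' = cell s0 ''adj''" "cell s ''start'' = cell s0 ''start''" "cell s ''deg'' = deg"
    using assms(1) by (simp_all add: same_input_def)
  have nbrs: "nbr y ` {..<deg y} = {z\<in>A - B. z \<rightarrow>\<^bsub>G\<^esub> y}" using bij_nbr_B[OF assms(2)] by (simp add: bij_betw_def)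
  have "finite R" using assms(5) finite by (auto intro: finite_subset)
  then have unique: "z = z'" if "z \<in> R" "z' \<in> R" "z \<rightarrow>\<^bsub>G\<^esub> y" "z' \<rightarrow>\<^bsub>G\<^esub> y" for z z'
    using that assms(7) card_le_Suc0_iff_eq[of "{z\<in>R. z \<rightarrow>\<^bsub>G\<^esub> y}"] by auto
  have step: "wp ?body I s' (k - (1 + bcost (Lt (Reg ''i'') (Cell ''deg'' (Reg ''y'')))))"
    if "I s' k" "reg s' ''i'' < deg y" for s' k
  proof -
    from that assms(3) inp obtain x i where I: "s' = s\<lparr>reg := (reg s)(''x'' := x, ''i'' := i)\<rparr>" "x \<in> R" "i < deg y"
      "\<forall>z\<in>nbr y ` {..<i} \<inter> R. z = x" "60 * (deg y - i) + 10 + K \<le> k"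
      unfolding I_def by auto
    let ?w = "nbr y i"
    have w: "?w \<in> A - B" "?w \<rightarrow>\<^bsub>G\<^esub> y" using nbrs I(3) by auto
    have sub: "z \<rightarrow>\<^bsub>G\<^esub> y" if "z \<in> nbr y ` {..<Suc i}" for z
      using nbrs I(3) that by force
    have k: "60 * (deg y - Suc i) + 70 + K \<le> k" using I(3,5) by auto
    show ?thesis
    proof (cases "?w \<in> R")
      case True
      have "\<forall>z\<in>nbr y ` {..<Suc i} \<inter> R. z = ?w" using True w sub unique by blast
      then have "I (s\<lparr>reg := (reg s)(''x'' := ?w, ''i'' := Suc i)\<rparr>) k'"
        if "60 * (deg y - Suc i) + 10 + K \<le> k'" for k'
        using that True I(3) unfolding I_def by (intro exI[of _ ?w] exI[of _ "Suc i"]) auto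
      then show ?thesis
        using I(1,3) k w True assms(3,4) inp by (auto simp: wp_simps neighbour_def incr_def)
    next
      case False
      have "\<forall>z\<in>nbr y ` {..<Suc i} \<inter> R. z = x" using False I(4) by (auto simp: lessThan_Suc)
      then have "I (s\<lparr>reg := (reg s)(''x'' := x, ''i'' := Suc i)\<rparr>) k'"
        if "60 * (deg y - Suc i) + 10 + K \<le> k'" for k'
        using that I(2,3) unfolding I_def by (intro exI[of _ x] exI[of _ "Suc i"]) auto
      then show ?thesis
        using I(1,3) k w False assms(3,4) inp by (auto simp: wp_simps neighbour_def incr_def)
    qed
  qed
  have "wp (Loop (Lt (Reg ''i'') (Cell ''deg'' (Reg ''y''))) ?body) Q (s\<lparr>reg := (reg s)(''i'' := 0)\<rparr>) k'"
    if "60 * deg y + 10 + K \<le> k'" for k'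
  proof (rule wp_Loop[where I = I])
    show "I (s\<lparr>reg := (reg s)(''i'' := 0)\<rparr>) k'"
      unfolding I_def using assms(6) that by (intro exI[of _ "reg s ''x''"] exI[of _ 0]) auto
  next
    fix s' k' assume I: "I s' k'" and "bval (Lt (Reg ''i'') (Cell ''deg'' (Reg ''y''))) s'"
    show "1 + bcost (Lt (Reg ''i'') (Cell ''deg'' (Reg ''y''))) \<le> k' \<and>
      wp ?body I s' (k' - (1 + bcost (Lt (Reg ''i'') (Cell ''deg'' (Reg ''y'')))))"
    proof -
      have "reg s' ''i'' < deg y" "5 \<le> k'"
        using I \<open>bval _ s'\<close> assms(3) inp unfolding I_def by auto
      then show ?thesis using step[OF I] by simp
    qed
  next
    fix s' k' assume "I s' k'" "\<not> bval (Lt (Reg ''i'') (Cell ''deg'' (Reg ''y''))) s'"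
    then obtain x where x: "s' = s\<lparr>reg := (reg s)(''x'' := x, ''i'' := deg y)\<rparr>" "x \<in> R"
      "\<forall>z\<in>nbr y ` {..<deg y} \<inter> R. z = x" "10 + K \<le> k'" using assms(3) inp unfolding I_def by auto
    have "Q s' (k' - (1 + bcost (Lt (Reg ''i'') (Cell ''deg'' (Reg ''y'')))))"
      unfolding x(1) by (rule assms(9)) (use x assms(5) nbrs in auto)
    then show "1 + bcost (Lt (Reg ''i'') (Cell ''deg'' (Reg ''y''))) \<le> k' \<and>
      Q s' (k' - (1 + bcost (Lt (Reg ''i'') (Cell ''deg'' (Reg ''y'')))))"
      using x(4) by simp
  qed
  then show ?thesis unfolding scan_def wp_simps using assms(8) by auto
qed

text \<open>The listing of neighbours is injective, so each counter is decremented once. The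
  invariant adds the decrements already made back to the counters and compares with the old counts
  for \<open>R\<close>; only at the end is this read as a count for \<open>R - {x}\<close>.\<close>

lemma wp_update:
  assumes "same_input s" "R \<subseteq> A - B" "x \<in> R" "reg s ''x'' = x"
    "\<forall>v\<in>B - A. cell s ''d'' v = card {z\<in>R. z \<rightarrow>\<^bsub>G\<^esub> v}"
    "bij_betw (cell s ''to'') {..<reg s ''tl''} {v\<in>B - A. cell s ''d'' v < 2}"
    "100 * deg x + 20 + K \<le> k"
    and Q: "\<And>s' k'. same_input s' \<Longrightarrow> reg s' ''moves'' = reg s ''moves'' \<Longrightarrow> reg s' ''p'' = reg s ''p'' \<Longrightarrow>
      cell s' ''from'' = cell s ''from'' \<Longrightarrow> cell s' ''on'' = cell s ''on'' \<Longrightarrow>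
      reg s ''tl'' \<le> reg s' ''tl'' \<Longrightarrow> \<forall>j<reg s ''tl''. cell s' ''to'' j = cell s ''to'' j \<Longrightarrow>
      \<forall>v\<in>B - A. cell s' ''d'' v = card {z\<in>R - {x}. z \<rightarrow>\<^bsub>G\<^esub> v} \<Longrightarrow>
      bij_betw (cell s' ''to'') {..<reg s' ''tl''} {v\<in>B - A. cell s' ''d'' v < 2} \<Longrightarrow> K \<le> k' \<Longrightarrow> Q s' k'"
  shows "wp update Q s k"
proof -
  let ?seen = "\<lambda>s. nbr x ` {..<reg s ''i''}"
  let ?I = "\<lambda>s' k. same_input s' \<and> reg s' ''x'' = x \<and> reg s' ''i'' \<le> deg x \<and>
    reg s' ''moves'' = reg s ''moves'' \<and> reg s' ''p'' = reg s ''p'' \<and>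
    cell s' ''from'' = cell s ''from'' \<and> cell s' ''on'' = cell s ''on'' \<and>
    reg s ''tl'' \<le> reg s' ''tl'' \<and> (\<forall>j<reg s ''tl''. cell s' ''to'' j = cell s ''to'' j) \<and>
    (\<forall>v\<in>B - A. cell s' ''d'' v + of_bool (v \<in> ?seen s') = card {z\<in>R. z \<rightarrow>\<^bsub>G\<^esub> v}) \<and>
    bij_betw (cell s' ''to'') {..<reg s' ''tl''} {v\<in>B - A. cell s' ''d'' v < 2} \<and>
    100 * (deg x - reg s' ''i'') + 10 + K \<le> k"
  let ?guard = "Lt (Reg ''i'') (Cell ''deg'' (Reg ''x''))"
  let ?body = "Seq (Set_Reg ''y'' (neighbour ''x''))
     (Seq (Set_Cell ''d'' (Reg ''y'') (Sub (Cell ''d'' (Reg ''y'')) (Num 1)))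
     (Seq (Cond (Conj (Lt (Num 0) (Cell ''d'' (Reg ''y''))) (Lt (Cell ''d'' (Reg ''y'')) (Num 2))) push Skip)
     (incr ''i'')))"
  have fin: "finite R" using assms(2) finite by (auto intro: finite_subset)
  have x: "x \<in> A - B" using assms(2,3) by auto
  have nbrs: "nbr x ` {..<deg x} = {y\<in>B - A. x \<rightarrow>\<^bsub>G\<^esub> y}" "inj_on (nbr x) {..<deg x}"
    using bij_nbr_A[OF x] by (simp_all add: bij_betw_def)
  have step: "wp ?body ?I s' (k - (1 + bcost ?guard))" if I: "?I s' k" and i: "reg s' ''i'' < deg x" for s' k
  proof -
    let ?y = "nbr x (reg s' ''i'')"
    have y: "?y \<in> B - A" "x \<rightarrow>\<^bsub>G\<^esub> ?y" using nbrs(1) i by auto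
    have unseen: "\<forall>j<reg s' ''i''. nbr x j \<noteq> ?y" using nbrs(2) i by (auto simp: inj_on_def)
    then have "?y \<notin> ?seen s'" by auto
    moreover have "cell s' ''d'' ?y + of_bool (?y \<in> ?seen s') = card {z\<in>R. z \<rightarrow>\<^bsub>G\<^esub> ?y}"
      using I y by blast
    ultimately have dy: "cell s' ''d'' ?y = card {z\<in>R. z \<rightarrow>\<^bsub>G\<^esub> ?y}" by simp
    \<comment> \<open>The vertex \<open>x\<close> itself is counted, so the truncated subtraction is
      exact.\<close>
    have "{z\<in>R. z \<rightarrow>\<^bsub>G\<^esub> ?y} \<noteq> {}" using assms(3) y by auto
    then have pos: "0 < cell s' ''d'' ?y" unfolding dy using fin by (simp add: card_gt_0_iff)
    have inp: "cell s' ''adj'' = cell s0 ''adj''" "cell s' ''start'' = cell s0 ''start''"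
      using I by (simp_all add: same_input_def)
    have k: "100 * (deg x - Suc (reg s' ''i'')) + 110 + K \<le> k" using I i by auto
    have seen: "nbr x ` {..<Suc (reg s' ''i'')} = insert ?y (?seen s')" by (simp add: lessThan_Suc)
    let ?d = "(cell s' ''d'')(?y := cell s' ''d'' ?y - 1)"
    have d: "\<forall>v\<in>B - A. ?d v + of_bool (v \<in> nbr x ` {..<Suc (reg s' ''i'')}) = card {z\<in>R. z \<rightarrow>\<^bsub>G\<^esub> v}"
    proof
      fix v assume v: "v \<in> B - A"
      then have "cell s' ''d'' v + of_bool (v \<in> ?seen s') = card {z\<in>R. z \<rightarrow>\<^bsub>G\<^esub> v}" using I by blast
      then show "?d v + of_bool (v \<in> nbr x ` {..<Suc (reg s' ''i'')}) = card {z\<in>R. z \<rightarrow>\<^bsub>G\<^esub> v}"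
        unfolding seen using dy pos by (cases "v = ?y") auto
    qed
    have bij: "bij_betw (cell s' ''to'') {..<reg s' ''tl''} {v\<in>B - A. cell s' ''d'' v < 2}"
      using I by blast
    let ?low = "{v\<in>B - A. ?d v < 2}"
    have same: "same_input s'" and frame: "reg s' ''x'' = x" "reg s' ''moves'' = reg s ''moves''"
      "reg s' ''p'' = reg s ''p''" "cell s' ''from'' = cell s ''from''" "cell s' ''on'' = cell s ''on''"
      "reg s ''tl'' \<le> reg s' ''tl''" "\<forall>j<reg s ''tl''. cell s' ''to'' j = cell s ''to'' j"
      using I by blast+
    show ?thesis
    proof (cases "cell s' ''d'' ?y = 2")
      case True
      have "bij_betw ((cell s' ''to'')(reg s' ''tl'' := ?y)) {..<Suc (reg s' ''tl'')}
          (insert ?y {v\<in>B - A. cell s' ''d'' v < 2})"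
        using bij True by (intro bij_betw_push) auto
      moreover have "insert ?y {v\<in>B - A. cell s' ''d'' v < 2} = ?low" using True y by auto
      ultimately have "bij_betw ((cell s' ''to'')(reg s' ''tl'' := ?y)) {..<Suc (reg s' ''tl'')} ?low"
        by argo
      then show ?thesis
        unfolding push_def incr_def neighbour_def
        using same frame i k inp d True
        by (simp add: wp_simps same_input_def; intro conjI; linarith)
    next
      \<comment> \<open>A counter of one drops to zero, with its vertex already queued; one of at
        least three stays at least two. Neither changes the set of low vertices.\<close>
      case False
      have "{v\<in>B - A. cell s' ''d'' v < 2} = ?low" using False pos y by auto
      then have low: "bij_betw (cell s' ''to'') {..<reg s' ''tl''} ?low" using bij by argo
      consider (one) "cell s' ''d'' ?y = Suc 0" | (many) e where "cell s' ''d'' ?y = Suc (Suc (Suc e))"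
        using False pos by (metis One_nat_def Suc_1 gr0_conv_Suc old.nat.exhaust)
      then show ?thesis
      proof cases
        case one
        then show ?thesis
          unfolding push_def incr_def neighbour_def
          using same frame i k inp d low one
          by (simp add: wp_simps same_input_def; intro conjI; linarith)
      next
        case many
        then show ?thesis
          unfolding push_def incr_def neighbour_def
          using same frame i k inp d low many
          by (simp add: wp_simps same_input_def; intro conjI; linarith)
      qed
    qed
  qed
  have "wp (Loop ?guard ?body) Q (s\<lparr>reg := (reg s)(''i'' := 0)\<rparr>) k'" if "100 * deg x + 10 + K \<le> k'" for k'
  proof (rule wp_Loop[where I = ?I])
    show "?I (s\<lparr>reg := (reg s)(''i'' := 0)\<rparr>) k'"
      using assms that by (simp add: same_input_def)
  next
    fix s' k' assume I: "?I s' k'" and "bval ?guard s'"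
    then show "1 + bcost ?guard \<le> k' \<and> wp ?body ?I s' (k' - (1 + bcost ?guard))"
      using step[OF I] by (simp add: same_input_def)
  next
    fix s' k' assume I: "?I s' k'" and "\<not> bval ?guard s'"
    then have i: "reg s' ''i'' = deg x" by (simp add: same_input_def)
    have "cell s' ''d'' v = card {z\<in>R - {x}. z \<rightarrow>\<^bsub>G\<^esub> v}" if v: "v \<in> B - A" for v
    proof -
      have "cell s' ''d'' v + of_bool (x \<rightarrow>\<^bsub>G\<^esub> v) = card {z\<in>R. z \<rightarrow>\<^bsub>G\<^esub> v}"
        using I v unfolding i nbrs(1) by auto
      moreover have "card {z\<in>R. z \<rightarrow>\<^bsub>G\<^esub> v} = card {z\<in>R - {x}. z \<rightarrow>\<^bsub>G\<^esub> v} + of_bool (x \<rightarrow>\<^bsub>G\<^esub> v)"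
      proof (cases "x \<rightarrow>\<^bsub>G\<^esub> v")
        case True
        then have "{z\<in>R. z \<rightarrow>\<^bsub>G\<^esub> v} = insert x {z\<in>R - {x}. z \<rightarrow>\<^bsub>G\<^esub> v}" using assms(3) by auto
        then show ?thesis using True fin by simp
      next
        case False
        then have "{z\<in>R. z \<rightarrow>\<^bsub>G\<^esub> v} = {z\<in>R - {x}. z \<rightarrow>\<^bsub>G\<^esub> v}" by auto
        then show ?thesis using False by simp
      qed
      ultimately show ?thesis by simp
    qed
    moreover have "K \<le> k' - (1 + bcost ?guard)" "1 + bcost ?guard \<le> k'" using I by auto
    ultimately show "1 + bcost ?guard \<le> k' \<and> Q s' (k' - (1 + bcost ?guard))"
      using Q[of s' "k' - (1 + bcost ?guard)"] I by blast
  qed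
  then show ?thesis unfolding update_def wp_simps using assms(7) by auto
qed

text \<open>\<open>R\<close> and \<open>S\<close> are not stored as such but determined by the moves
  made. Counters are kept up for targets already used, so \<open>to\<close> lists all vertices of
  low count: used targets up to \<open>moves\<close>, the queue from there on.\<close>

definition peel_inv :: "nat set \<Rightarrow> nat set \<Rightarrow> memory \<Rightarrow> bool" where
  "peel_inv R S s \<longleftrightarrow> same_input s \<and> peeling (dominates G) (A - B) (B - A) (output_moves s) R S \<and>
     (\<forall>v\<in>A \<union> B. cell s ''on'' v = of_bool (v \<in> R)) \<and>
     (\<forall>v\<in>B - A. cell s ''d'' v = card {z\<in>R. z \<rightarrow>\<^bsub>G\<^esub> v}) \<and>
     bij_betw (cell s ''to'') {..<reg s ''tl''} {v\<in>B - A. cell s ''d'' v < 2} \<and>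
     reg s ''moves'' \<le> reg s ''tl'' \<and> R \<subseteq> a ` {reg s ''p''..<n}"

text \<open>
  The credit pays for the remaining moves, for scanning the adjacency list of each remaining vertex
  once, and for advancing \<open>p\<close> through \<open>A\<close>.
\<close>

definition credit :: "nat set \<Rightarrow> nat set \<Rightarrow> nat \<Rightarrow> nat" where
  "credit R S p = 300 * card S + 60 * sum deg S + 100 * sum deg R + 20 * (n - p)"

lemma peel_inv_facts:
  assumes "peel_inv R S s"
  shows "R \<subseteq> A - B" "S \<subseteq> B - A" "card R = card S" "S = B - A - cell s ''to'' ` {..<reg s ''moves''}"
    "finite R" "finite S"
proof -
  have p: "peeling (dominates G) (A - B) (B - A) (output_moves s) R S"
    using assms by (simp add: peel_inv_def)
  have "snd ` set (output_moves s) = cell s ''to'' ` {..<reg s ''moves''}"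
    by (force simp: output_moves_def)
  then show S: "S = B - A - cell s ''to'' ` {..<reg s ''moves''}" and "R \<subseteq> A - B" "S \<subseteq> B - A"
    using peeling_remainder[OF p] by auto
  then show "finite R" "finite S" using finite by (auto intro: finite_subset)
  show "card R = card S" using peeling_card[OF p] finite card_diff_eq by simp
qed

text \<open>Removing \<open>x\<close> and \<open>y\<close> releases 300 plus the shares of their
  adjacency lists, which pays for everything but the progress of \<open>p\<close>. The slack of 10
  absorbs the loop guard, evaluated before the move.\<close>

lemma wp_move:
  assumes inv: "peel_inv R S s" and m: "reg s ''moves'' < reg s ''tl''"
    and k: "credit R S (reg s ''p'') + K \<le> k + 10"
    and Q: "\<And>x y s' k'. peel_inv (R - {x}) (S - {y}) s' \<Longrightarrow>
       credit (R - {x}) (S - {y}) (reg s' ''p'') + K \<le> k' \<Longrightarrow> Q s' k'"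
  shows "wp move Q s k"
proof -
  note R = peel_inv_facts[OF inv]
  let ?m = "reg s ''moves''"
  define y where "y = cell s ''to'' ?m"
  have same: "same_input s" and peel: "peeling (dominates G) (A - B) (B - A) (output_moves s) R S"
    and on: "\<forall>v\<in>A \<union> B. cell s ''on'' v = of_bool (v \<in> R)"
    and d: "\<forall>v\<in>B - A. cell s ''d'' v = card {z\<in>R. z \<rightarrow>\<^bsub>G\<^esub> v}"
    and bij: "bij_betw (cell s ''to'') {..<reg s ''tl''} {v\<in>B - A. cell s ''d'' v < 2}"
    and p: "R \<subseteq> a ` {reg s ''p''..<n}"
    using inv unfolding peel_inv_def by blast+
  have "y \<in> {v\<in>B - A. cell s ''d'' v < 2}"
    unfolding y_def using bij_betwE[OF bij] m by blast
  then have y: "y \<in> B - A" "card {z\<in>R. z \<rightarrow>\<^bsub>G\<^esub> y} \<le> 1" using d by auto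
  \<comment> \<open>Queue entries are distinct, so the head is not an earlier target and still
    belongs to \<open>S\<close>.\<close>
  have "cell s ''to'' j \<noteq> y" if "j < ?m" for j
    using that m inj_onD[OF bij_betw_imp_inj_on[OF bij], of j ?m] unfolding y_def by auto
  then have "y \<in> S" unfolding R(4) using y by auto
  then have "R \<noteq> {}" using R(3,6) by auto
  let ?update = "Seq (Set_Cell ''from'' (Reg ''moves'') (Reg ''x''))
     (Seq (Set_Cell ''on'' (Reg ''x'') (Num 0)) (Seq (incr ''moves'') update))"
  have fin: "wp ?update Q s3 k3"
    if s3: "same_input s3" "reg s3 ''x'' = x" "reg s3 ''moves'' = ?m" "reg s3 ''tl'' = reg s ''tl''"
      "cell s3 = cell s" and x: "x \<in> R" "\<forall>z\<in>R. z \<rightarrow>\<^bsub>G\<^esub> y \<longrightarrow> z = x"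
      and p3: "R \<subseteq> a ` {reg s3 ''p''..<n}"
      and k3: "100 * deg x + 50 + credit (R - {x}) (S - {y}) (reg s3 ''p'') + K \<le> k3" for s3 k3 x
  proof -
    define s4 where "s4 = s3\<lparr>
      cell := (cell s)(''from'' := (cell s ''from'')(?m := x), ''on'' := (cell s ''on'')(x := 0)),
      reg := (reg s3)(''moves'' := Suc ?m)\<rparr>"
    have "wp update Q s4 k4" if k4: "100 * deg x + 20 + (credit (R - {x}) (S - {y}) (reg s3 ''p'') + K) \<le> k4" for k4
    proof (rule wp_update[OF _ R(1) x(1) _ _ _ k4])
      show "same_input s4" using s3(1,5) by (simp add: same_input_def s4_def)
      show "reg s4 ''x'' = x" using s3(2) by (simp add: s4_def)
      show "\<forall>v\<in>B - A. cell s4 ''d'' v = card {z\<in>R. z \<rightarrow>\<^bsub>G\<^esub> v}" using d by (simp add: s4_def)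
      show "bij_betw (cell s4 ''to'') {..<reg s4 ''tl''} {v\<in>B - A. cell s4 ''d'' v < 2}"
        using bij s3(4) by (simp add: s4_def)
    next
      fix s' k'
      assume s': "same_input s'" "reg s' ''moves'' = reg s4 ''moves''" "reg s' ''p'' = reg s4 ''p''"
        "cell s' ''from'' = cell s4 ''from''" "cell s' ''on'' = cell s4 ''on''"
        "reg s4 ''tl'' \<le> reg s' ''tl''" "\<forall>j<reg s4 ''tl''. cell s' ''to'' j = cell s4 ''to'' j"
        "\<forall>v\<in>B - A. cell s' ''d'' v = card {z\<in>R - {x}. z \<rightarrow>\<^bsub>G\<^esub> v}"
        "bij_betw (cell s' ''to'') {..<reg s' ''tl''} {v\<in>B - A. cell s' ''d'' v < 2}"
        and k': "credit (R - {x}) (S - {y}) (reg s3 ''p'') + K \<le> k'"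
      \<comment> \<open>Pushes write only at or beyond the old \<open>tl\<close>, so the entry of
        the current target survives.\<close>
      have to: "cell s' ''to'' j = cell s ''to'' j" if "j \<le> ?m" for j
        using s'(7) that m s3(4) by (simp add: s4_def)
      have "output_moves s' = output_moves s @ [(x, y)]"
        using s'(2,4) to by (auto simp: output_moves_def s4_def y_def)
      then have "peeling (dominates G) (A - B) (B - A) (output_moves s') (R - {x}) (S - {y})"
        using peeling_snoc[OF peel x(1) \<open>y \<in> S\<close>] x(2) by simp
      moreover have "\<forall>v\<in>A \<union> B. cell s' ''on'' v = of_bool (v \<in> R - {x})"
        using s'(5) on by (simp add: s4_def)
      moreover have "reg s' ''moves'' \<le> reg s' ''tl''" "R - {x} \<subseteq> a ` {reg s' ''p''..<n}"
        using s'(2,3,6) s3(3,4) m p3 by (auto simp: s4_def)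
      ultimately have "peel_inv (R - {x}) (S - {y}) s'" using s' by (simp add: peel_inv_def)
      then show "Q s' k'" using Q k' s'(3) by (simp add: s4_def)
    qed
    then show ?thesis
      using k3 s3(2,3,5) by (auto simp: wp_simps incr_def s4_def)
  qed
  have "wp (Seq (Set_Reg ''x'' (Cell ''A'' (Reg ''p''))) (Seq scan ?update)) Q s2 k2"
    if s2: "same_input s2" "reg s2 ''y'' = y" "reg s2 ''moves'' = ?m" "reg s2 ''tl'' = reg s ''tl''"
      "cell s2 = cell s" and p2: "R \<subseteq> a ` {reg s2 ''p''..<n}" "a (reg s2 ''p'') \<in> R"
      and k2: "credit R S (reg s2 ''p'') + K \<le> k2 + 100" for s2 k2
  proof -
    define s2' where "s2' = s2\<lparr>reg := (reg s2)(''x'' := a (reg s2 ''p''))\<rparr>"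
    have "wp scan (wp ?update Q) s2' k3" if k3: "credit R S (reg s2 ''p'') + K \<le> k3 + 150" for k3
    proof -
      \<comment> \<open>Of the 300 units released by \<open>y\<close>, at most 170 are spent up to
        here; \<open>60 * deg y\<close> pays for the scan.\<close>
      let ?K = "credit R S (reg s2 ''p'') + K - 170 - 60 * deg y"
      have cS: "card S = Suc (card (S - {y}))" "sum deg S = deg y + sum deg (S - {y})"
        using \<open>y \<in> S\<close> R(6) by (simp_all add: sum.remove card_Suc_Diff1 del: card_Diff_insert)
      show ?thesis
      proof (rule wp_scan[where R = R and y = y and K = ?K])
        show "same_input s2'" using s2(1) by (simp add: same_input_def s2'_def)
        show "reg s2' ''y'' = y" "reg s2' ''x'' \<in> R" using s2(2) p2(2) by (simp_all add: s2'_def)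
        show "\<forall>v\<in>A. cell s2' ''on'' v = of_bool (v \<in> R)" using on s2(5) by (simp add: s2'_def)
        show "60 * deg y + 20 + ?K \<le> k3" using k3 cS by (simp add: credit_def)
      next
        fix x i k assume x: "x \<in> R" "\<forall>z\<in>R. z \<rightarrow>\<^bsub>G\<^esub> y \<longrightarrow> z = x" and k: "?K \<le> k"
        have "sum deg R = deg x + sum deg (R - {x})" using x(1) R(5) by (simp add: sum.remove)
        then have "100 * deg x + 50 + credit (R - {x}) (S - {y}) (reg s2 ''p'') + K \<le> k"
          using k cS by (simp add: credit_def)
        then show "wp ?update Q (s2'\<lparr>reg := (reg s2')(''x'' := x, ''i'' := i)\<rparr>) k"
          using s2 p2 x by (intro fin[of _ x]) (simp_all add: s2'_def same_input_def)
      qed (use y R(1) in auto)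
    qed
    moreover have "cell s2 ''A'' = a" using s2(1) by (simp add: same_input_def)
    moreover have "300 \<le> credit R S (reg s2 ''p'')"
      using \<open>y \<in> S\<close> R(6) card_gt_0_iff[of S] by (auto simp: credit_def)
    ultimately show ?thesis using k2 by (auto simp: wp_simps s2'_def)
  qed
  note rest = this
  have "wp advance (wp (Seq (Set_Reg ''x'' (Cell ''A'' (Reg ''p''))) (Seq scan ?update)) Q)
      (s\<lparr>reg := (reg s)(''y'' := y)\<rparr>) k1" if k1: "credit R S (reg s ''p'') + K \<le> k1 + 30" for k1
  \<comment> \<open>\<open>credit R S n\<close> is the credit without the share of \<open>p\<close>,
    because \<open>n - n = 0\<close>; that share is what \<open>wp_advance\<close> consumes.\<close>
  proof (rule wp_advance[where R = R and K = "credit R S n + K - 70"])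
    show "20 * (n - reg (s\<lparr>reg := (reg s)(''y'' := y)\<rparr>) ''p'') + 20 + (credit R S n + K - 70) \<le> k1"
      using k1 \<open>y \<in> S\<close> R(6) card_gt_0_iff[of S] by (auto simp: credit_def)
  next
    fix p k assume "R \<subseteq> a ` {p..<n}" "p < n" "a p \<in> R" "20 * (n - p) + (credit R S n + K - 70) \<le> k"
    then show "wp (Seq (Set_Reg ''x'' (Cell ''A'' (Reg ''p''))) (Seq scan ?update)) Q
        (s\<lparr>reg := (reg s)(''y'' := y)\<rparr>\<lparr>reg := (reg (s\<lparr>reg := (reg s)(''y'' := y)\<rparr>))(''p'' := p)\<rparr>) k"
      using same by (intro rest) (simp_all add: same_input_def credit_def)
  qed (use same on p \<open>R \<noteq> {}\<close> in \<open>auto simp: same_input_def\<close>)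
  moreover have "300 \<le> credit R S (reg s ''p'')"
    using \<open>y \<in> S\<close> R(6) card_gt_0_iff[of S] by (auto simp: credit_def)
  ultimately show ?thesis using k by (auto simp: move_def wp_simps y_def)
qed

text \<open>With both degree sums at most \<open>2 * n\<close>, the initial credit is at most
  \<open>(300 + 120 + 200 + 20) * n = 640 * n\<close>. Marking and initialising take
  \<open>(20 + 20 + 60) * n\<close> more, and the total is rounded up.\<close>

lemma wp_reconfigure:
  assumes "800 * n + 200 \<le> k"
  shows "wp reconfigure (\<lambda>s k. peeling (dominates G) (A - B) (B - A) (output_moves s) {} {}) s0 k"
proof -
  let ?Q = "\<lambda>s (k :: nat). peeling (dominates G) (A - B) (B - A) (output_moves s) {} {}"
  let ?I = "\<lambda>s k. \<exists>R S. peel_inv R S s \<and> credit R S (reg s ''p'') + 10 \<le> k"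
  let ?guard = "Lt (Reg ''moves'') (Reg ''tl'')"
  have main: "wp (Loop ?guard move) ?Q s k" if I: "?I s k" for s k
  proof (rule wp_Loop[where I = ?I])
    show "?I s k" by (rule I)
  next
    fix s k assume "?I s k" and b: "bval ?guard s"
    then obtain R S where RS: "peel_inv R S s" "credit R S (reg s ''p'') + 10 \<le> k" by blast
    have "wp move ?I s (k - (1 + bcost ?guard))"
      by (rule wp_move[OF RS(1), where K = 10]) (use b RS(2) in auto)
    then show "1 + bcost ?guard \<le> k \<and> wp move ?I s (k - (1 + bcost ?guard))" using RS(2) by auto
  next
    fix s k assume "?I s k" and b: "\<not> bval ?guard s"
    then obtain R S where inv: "peel_inv R S s" and k: "10 \<le> k" by fastforce
    note R = peel_inv_facts[OF inv]
    have bij: "bij_betw (cell s ''to'') {..<reg s ''tl''} {v\<in>B - A. cell s ''d'' v < 2}"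
      and d: "\<forall>v\<in>B - A. cell s ''d'' v = card {z\<in>R. z \<rightarrow>\<^bsub>G\<^esub> v}"
      and peel: "peeling (dominates G) (A - B) (B - A) (output_moves s) R S"
      and "reg s ''moves'' = reg s ''tl''"
      using inv b by (auto simp: peel_inv_def)
    \<comment> \<open>With an empty queue every vertex of low count has been a target, so all of
      \<open>S\<close> has counters of at least two. By \<open>exists_low_degree\<close> this is
      possible only for empty \<open>S\<close>.\<close>
    then have "S = B - A - {v\<in>B - A. cell s ''d'' v < 2}" using R(4) by (simp add: bij_betw_def)
    then have "S = {}" using exists_low_degree[OF R(1-3)] d by fastforce
    moreover from this have "R = {}" using R(3,5) by simp
    ultimately show "1 + bcost ?guard \<le> k \<and> ?Q s (k - (1 + bcost ?guard))" using peel k by simp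
  qed
  let ?main = "Seq (Set_Reg ''moves'' (Num 0)) (Seq (Set_Reg ''p'' (Num 0)) (Loop ?guard move))"
  have loop: "wp ?main ?Q s k"
    if "same_input s" "\<forall>v\<in>A \<union> B. cell s ''on'' v = of_bool (v \<in> A - B)" "\<forall>v\<in>B - A. cell s ''d'' v = deg v"
      "bij_betw (cell s ''to'') {..<reg s ''tl''} {v\<in>B - A. cell s ''d'' v < 2}" "640 * n + 30 \<le> k" for s k
  proof -
    let ?s = "s\<lparr>reg := (reg s)(''moves'' := 0, ''p'' := 0)\<rparr>"
    have "a ` {0..<n} = A" using bij_a by (simp add: bij_betw_def atLeast0LessThan)
    then have "peel_inv (A - B) (B - A) ?s"
      using that deg_B by (auto simp: peel_inv_def same_input_def output_moves_def)
    moreover have "card (B - A) \<le> n" using card_diff_eq card_mono[of A "A - B"] finite by simp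
    then have "credit (A - B) (B - A) (reg ?s ''p'') + 20 \<le> k"
      using sum_deg that(5) by (simp add: credit_def)
    ultimately have "wp (Loop ?guard move) ?Q ?s k'" if "k \<le> k' + 10" for k'
      using that by (intro main exI[of _ "A - B"] exI[of _ "B - A"]) auto
    then show ?thesis using that(5) by (auto simp: wp_simps)
  qed
  have "wp init (wp ?main ?Q) s k"
    if "same_input s" "\<forall>v\<in>A \<union> B. cell s ''on'' v = of_bool (v \<in> A)" "700 * n + 60 \<le> k" for s k
    by (rule wp_mono[OF wp_init[OF that(1,2), where K = "640 * n + 40"]]) (use that(3) loop in auto)
  then have "wp (mark ''A'' 1) (wp (Seq init ?main) ?Q) s k"
    if "same_input s" "\<forall>v\<in>B. cell s ''on'' v = 0" "720 * n + 100 \<le> k" for s k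
    by (intro wp_mono[OF wp_mark_A[OF that(1,2), where K = "700 * n + 70"]])
      (use that(3) in \<open>auto simp: wp_Seq[of init]\<close>)
  then have "wp (mark ''B'' 0) (wp (Seq (mark ''A'' 1) (Seq init ?main)) ?Q) s0 k" if "740 * n + 140 \<le> k" for k
    by (intro wp_mono[OF wp_mark_B[OF same_input_start, where K = "720 * n + 110"]])
      (use that in \<open>auto simp: wp_Seq[of "mark ''A'' 1"] simp del: One_nat_def\<close>)
  then show ?thesis unfolding reconfigure_def wp_Seq[of "mark ''B'' 0"] using assms by simp
qed

end

theorem theorem5:
  shows "(\<forall>(G :: ('a, 'b) pre_digraph) A B.
            graph G \<longrightarrow> independent_set G A \<longrightarrow> independent_set G B \<longrightarrow> card A = card B \<longrightarrow>
            even_hole_free (piran_graph G A B) \<longrightarrow>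
            TJ_reconfigurable G A B) \<and>
         (\<exists>(prog :: com) (T :: nat \<Rightarrow> nat).
            (\<lambda>n. real (T n)) \<in> O(\<lambda>n. real n) \<and>
            (\<forall>(G :: (nat, nat \<times> nat) pre_digraph) A B s.
               graph G \<longrightarrow> independent_set G A \<longrightarrow> independent_set G B \<longrightarrow> card A = card B \<longrightarrow>
               even_hole_free (piran_graph G A B) \<longrightarrow>
               encodes_input G A B s \<longrightarrow>
               (\<exists>t s'. runs prog s t s' \<and> t \<le> T (card A) \<and>
                  shortest_TJ_path G A B (token_sets A (output_moves s')))))"
proof (intro conjI)
  show "\<forall>(G :: ('a, 'b) pre_digraph) A B.
            graph G \<longrightarrow> independent_set G A \<longrightarrow> independent_set G B \<longrightarrow> card A = card B \<longrightarrow>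
            even_hole_free (piran_graph G A B) \<longrightarrow> TJ_reconfigurable G A B"
    by (auto intro: piran_forest.TJ_reconfigurable simp: piran_forest_def)
next
  \<comment> \<open>For \<open>n\<close> at least 1 the constant 200 is at most
    \<open>200 * n\<close>, whence the factor 1000.\<close>
  have "(\<lambda>n. real (800 * n + 200)) \<in> O(\<lambda>n. real n)"
    by (rule bigoI[where c = 1000]) (auto simp: eventually_at_top_linorder intro!: exI[of _ 1])
  moreover have "\<exists>t s'. runs reconfigure s t s' \<and> t \<le> 800 * card A + 200 \<and>
      shortest_TJ_path G A B (token_sets A (output_moves s'))"
    if "graph G" "independent_set G A" "independent_set G B" "card A = card B"
      "even_hole_free (piran_graph G A B)" "encodes_input G A B s"
    for G :: "(nat, nat \<times> nat) pre_digraph" and A B s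
  proof -
    interpret piran_input G A B s by (intro piran_input.intro piran_forest.intro piran_input_axioms.intro that)
    show ?thesis using wp_reconfigure[OF order_refl] peeling_shortest_TJ_path unfolding wp_def by blast
  qed
  ultimately show "\<exists>(prog :: com) (T :: nat \<Rightarrow> nat).
            (\<lambda>n. real (T n)) \<in> O(\<lambda>n. real n) \<and>
            (\<forall>(G :: (nat, nat \<times> nat) pre_digraph) A B s.
               graph G \<longrightarrow> independent_set G A \<longrightarrow> independent_set G B \<longrightarrow> card A = card B \<longrightarrow>
               even_hole_free (piran_graph G A B) \<longrightarrow>
               encodes_input G A B s \<longrightarrow>
               (\<exists>t s'. runs prog s t s' \<and> t \<le> T (card A) \<and>
                  shortest_TJ_path G A B (token_sets A (output_moves s'))))"
    by (intro exI[of _ reconfigure] exI[of _ "\<lambda>n. 800 * n + 200"]) auto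
qed

end
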